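(* Let $G$ be a graph such that $|E(H)| \le \frac{14|V(H)|+5}{9}$ for every subgraph $H$ of $G$. Then $G$ is $(1,3)$-colorable.
   Context: Graphs are finite and simple. A graph $G$ is $(1,3)$-colorable if its vertex set can be partitioned into two (possibly empty) subsets $V_1$ and $V_2$ such that every vertex of the induced subgraph $G[V_1]$ has degree at most $1$ in $G[V_1]$, and every vertex of $G[V_2]$ has degree at most $3$ in $G[V_2]$. *)

theory Defs
  imports Complex_Main
begin

text \<open>
  A graph is given by its vertex set and its edge set, an edge being a two-element set of
  vertices; so there are no loops and no multiple edges.  The empty graph is allowed.
\<close>

definition finite_simple_graph :: "'a set \<Rightarrow> 'a set set \<Rightarrow> bool" where
  "finite_simple_graph V E \<longleftrightarrow> finite V \<and> (\<forall>e\<in>E. e \<subseteq> V \<and> card e = 2)"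

definition subgraph :: "'a set \<Rightarrow> 'a set set \<Rightarrow> 'a set \<Rightarrow> 'a set set \<Rightarrow> bool" where
  "subgraph W F V E \<longleftrightarrow> finite_simple_graph W F \<and> W \<subseteq> V \<and> F \<subseteq> E"

definition induced_edges :: "'a set set \<Rightarrow> 'a set \<Rightarrow> 'a set set" where
  "induced_edges E W = {e \<in> E. e \<subseteq> W}"

definition degree :: "'a set set \<Rightarrow> 'a \<Rightarrow> nat" where
  "degree E v = card {e \<in> E. v \<in> e}"

definition colorable :: "nat \<Rightarrow> nat \<Rightarrow> 'a set \<Rightarrow> 'a set set \<Rightarrow> bool" where
  "colorable d1 d2 V E \<longleftrightarrow>
     (\<exists>V1 V2. V1 \<union> V2 = V \<and> V1 \<inter> V2 = {} \<and>
        (\<forall>v\<in>V1. degree (induced_edges E V1) v \<le> d1) \<and>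
        (\<forall>v\<in>V2. degree (induced_edges E V2) v \<le> d2))"

end

theory Submission
  imports Defs
begin

text \<open>
  Give a vertex the state \<open>(p, q)\<close>: it may have fewer than \<open>p\<close> neighbours of its own colour when
  coloured \<open>True\<close> and fewer than \<open>q\<close> when coloured \<open>False\<close>; initially \<open>p = 2\<close> and \<open>q = 4\<close>.  The
  potential of a set is the sum of its vertex weights minus \<open>9\<close> per edge.  The weights are
  tuned so that forbidding \<open>True\<close> at a vertex costs at most \<open>8\<close> and forbidding \<open>False\<close> at
  most \<open>9\<close>: after colouring a part \<open>Y\<close> of the graph, the restrictions imposed on the rest are paid
  by the edges leaving \<open>Y\<close>.  In a minimal counterexample every proper subset therefore has
  potential at least \<open>-1\<close>, and at least \<open>2\<close> if its complement has four or more vertices.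
  This leaves room to lower the capacities of some vertices before colouring a proper subgraph,
  which yields lower bounds on vertex degrees in terms of the number of neighbours that are
  almost unrestricted vertices of degree two.  Discharging then shows that colouring these vertices
  and those that cannot be \<open>False\<close> with \<open>True\<close>, and all others with \<open>False\<close>, works (up to
  one vertex), since otherwise the potential of the whole graph is at most \<open>-6\<close>.
\<close>

section \<open>Adjacency, degrees and edge counts\<close>

locale simple_edges =
  fixes E :: "'a set set"
  assumes card_edge: "e \<in> E \<Longrightarrow> card e = 2"
begin

definition adj :: "'a \<Rightarrow> 'a \<Rightarrow> bool" where
  "adj u v \<longleftrightarrow> {u, v} \<in> E"

definition nbs :: "'a \<Rightarrow> 'a set \<Rightarrow> 'a set" where
  "nbs v U = {u \<in> U. adj v u}"

definition dg :: "'a \<Rightarrow> 'a set \<Rightarrow> nat" where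
  "dg v U = card (nbs v U)"

definition ne :: "'a set \<Rightarrow> nat" where
  "ne U = card (induced_edges E U)"

lemma adj_sym: "adj u v \<longleftrightarrow> adj v u"
  by (simp add: adj_def insert_commute)

lemma adj_irrefl [simp]: "\<not> adj u u"
  using card_edge[of "{u}"] by (auto simp: adj_def)

lemma finite_nbs [simp]: "finite U \<Longrightarrow> finite (nbs v U)"
  by (simp add: nbs_def)

lemma finite_induced [simp]: "finite U \<Longrightarrow> finite (induced_edges E U)"
  by (rule finite_subset[of _ "Pow U"]) (auto simp: induced_edges_def)

lemma dg_empty [simp]: "dg v {} = 0"
  by (simp add: dg_def nbs_def)

lemma ne_empty [simp]: "ne {} = 0"
  using card_edge[of "{}"] by (auto simp: ne_def induced_edges_def)

lemma dg_Un:
  assumes "finite Y" "finite U" "Y \<inter> U = {}"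
  shows "dg v (Y \<union> U) = dg v Y + dg v U"
proof -
  have "nbs v (Y \<union> U) = nbs v Y \<union> nbs v U" "nbs v Y \<inter> nbs v U = {}"
    using assms by (auto simp: nbs_def)
  then show ?thesis using assms by (simp add: dg_def card_Un_disjoint)
qed

lemma dg_insert:
  assumes "finite U" "u \<notin> U"
  shows "dg v (insert u U) = dg v U + (if adj v u then 1 else 0)"
proof -
  have "nbs v (insert u U) = (if adj v u then insert u (nbs v U) else nbs v U)"
    by (auto simp: nbs_def)
  moreover have "u \<notin> nbs v U" using assms by (simp add: nbs_def)
  ultimately show ?thesis using assms by (simp add: dg_def)
qed

lemma dg_mono: "finite U \<Longrightarrow> Y \<subseteq> U \<Longrightarrow> dg v Y \<le> dg v U"
  unfolding dg_def by (rule card_mono) (auto simp: nbs_def)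

lemma dg_pos: "finite U \<Longrightarrow> u \<in> U \<Longrightarrow> adj v u \<Longrightarrow> dg v U \<ge> 1"
  unfolding dg_def using card_gt_0_iff[of "nbs v U"] by (force simp: nbs_def)

lemma ne_insert:
  assumes "finite U" "v \<notin> U"
  shows "ne (insert v U) = ne U + dg v U"
proof -
  have eq: "induced_edges E (insert v U) = induced_edges E U \<union> (\<lambda>u. {v, u}) ` nbs v U"
    (is "?l = ?r")
  proof
    show "?l \<subseteq> ?r"
    proof
      fix e assume e: "e \<in> ?l"
      then have "e \<in> E" "e \<subseteq> insert v U" by (auto simp: induced_edges_def)
      show "e \<in> ?r"
      proof (cases "v \<in> e")
        case True
        from card_edge[OF \<open>e \<in> E\<close>] obtain a b where ab: "e = {a, b}" "a \<noteq> b"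
          by (meson card_2_iff)
        with True obtain u where u: "e = {v, u}" "u \<noteq> v" by auto
        then have "u \<in> nbs v U" using \<open>e \<in> E\<close> \<open>e \<subseteq> insert v U\<close>
          by (auto simp: nbs_def adj_def)
        with u show ?thesis by blast
      next
        case False
        then show ?thesis using \<open>e \<in> E\<close> \<open>e \<subseteq> insert v U\<close> by (auto simp: induced_edges_def)
      qed
    qed
    show "?r \<subseteq> ?l" by (auto simp: induced_edges_def nbs_def adj_def)
  qed
  have "induced_edges E U \<inter> (\<lambda>u. {v, u}) ` nbs v U = {}"
    using assms by (auto simp: induced_edges_def)
  moreover have "inj_on (\<lambda>u. {v, u}) (nbs v U)"
    by (auto simp: inj_on_def doubleton_eq_iff)
  ultimately show ?thesis
    using assms by (simp add: ne_def eq card_Un_disjoint card_image dg_def)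
qed

lemma ne_Un:
  assumes "finite U" "finite Y" "Y \<inter> U = {}"
  shows "ne (Y \<union> U) = ne Y + ne U + (\<Sum>u\<in>U. dg u Y)"
  using assms
proof (induction U)
  case (insert u U)
  have "ne (Y \<union> insert u U) = ne (insert u (Y \<union> U))" by simp
  also have "\<dots> = ne (Y \<union> U) + dg u (Y \<union> U)" using insert by (subst ne_insert) auto
  also have "dg u (Y \<union> U) = dg u Y + dg u U" using insert by (subst dg_Un) auto
  finally show ?case using insert by (simp add: ne_insert)
qed simp

lemma sum_adj: "finite U \<Longrightarrow> (\<Sum>u\<in>U. if adj u v then 1 else 0) = dg v U"
proof (induction U rule: finite_induct)
  case (insert u U)
  then show ?case by (simp add: dg_insert adj_sym)
qed simp

lemma sum_dg: "finite U \<Longrightarrow> (\<Sum>v\<in>U. dg v U) = 2 * ne U"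
proof (induction U rule: finite_induct)
  case (insert v U)
  have "(\<Sum>u\<in>U. dg u (insert v U)) = (\<Sum>u\<in>U. dg u U) + (\<Sum>u\<in>U. if adj u v then 1 else 0)"
    using insert by (subst sum.distrib[symmetric], intro sum.cong) (auto simp: dg_insert)
  then show ?case using insert by (simp add: dg_insert ne_insert sum_adj)
qed simp


section \<open>Capacities, potential and admissibility\<close>

definition gq :: "nat \<Rightarrow> int" where
  "gq q = (if q \<le> 1 then - 3 else 3 * int q - 6)"

text \<open>The state \<open>(2, 4)\<close> weighs 14, the coefficient in the edge bound. Lowering
  \<open>q\<close> by one loses at most 3, and nothing at all from 1 to 0; several later steps rely
  on this.\<close>

definition wt :: "('a \<Rightarrow> nat) \<Rightarrow> ('a \<Rightarrow> nat) \<Rightarrow> 'a \<Rightarrow> int" where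
  "wt p q v = 4 * int (p v) + gq (q v)"

definition rho :: "('a \<Rightarrow> nat) \<Rightarrow> ('a \<Rightarrow> nat) \<Rightarrow> 'a set \<Rightarrow> int" where
  "rho p q U = (\<Sum>v\<in>U. wt p q v) - 9 * int (ne U)"

definition cap :: "('a \<Rightarrow> nat) \<Rightarrow> ('a \<Rightarrow> nat) \<Rightarrow> bool \<Rightarrow> 'a \<Rightarrow> nat" where
  "cap p q b v = (if b then p v else q v)"

definition same :: "('a \<Rightarrow> bool) \<Rightarrow> bool \<Rightarrow> 'a set \<Rightarrow> 'a \<Rightarrow> 'a set" where
  "same c b U v = {u \<in> U. adj v u \<and> c u = b}"

definition valid :: "'a set \<Rightarrow> ('a \<Rightarrow> nat) \<Rightarrow> ('a \<Rightarrow> nat) \<Rightarrow> ('a \<Rightarrow> bool) \<Rightarrow> bool" where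
  "valid V p q c \<longleftrightarrow> (\<forall>v\<in>V. card (same c (c v) V v) < cap p q (c v) v)"

text \<open>As \<open>gq 0 = gq 1\<close>, the potential cannot tell a vertex that may be
  \<open>False\<close> from one that may not. The last clause makes up for this: vertices with
  \<open>q = 0\<close> are all forced to be \<open>True\<close>, so their adjacencies must respect
  \<open>p\<close>.\<close>

definition admissible :: "'a set \<Rightarrow> ('a \<Rightarrow> nat) \<Rightarrow> ('a \<Rightarrow> nat) \<Rightarrow> bool" where
  "admissible V p q \<longleftrightarrow>
     (\<forall>v\<in>V. p v \<le> 2 \<and> q v \<le> 4) \<and>
     (\<forall>U. U \<subseteq> V \<longrightarrow> rho p q U \<ge> - 5) \<and>
     (\<forall>v\<in>V. q v = 0 \<longrightarrow> card {u \<in> V. adj v u \<and> q u = 0} < p v)"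

lemma finite_same [simp]: "finite U \<Longrightarrow> finite (same c b U v)"
  by (simp add: same_def)

lemma rho_empty [simp]: "rho p q {} = 0"
  by (simp add: rho_def)

lemma rho_insert:
  "finite U \<Longrightarrow> v \<notin> U \<Longrightarrow> rho p q (insert v U) = rho p q U + wt p q v - 9 * int (dg v U)"
  by (simp add: rho_def ne_insert)

lemma rho_Un:
  assumes "finite U" "finite Y" "Y \<inter> U = {}"
  shows "rho p q (Y \<union> U) = rho p q Y + rho p q U - 9 * int (\<Sum>u\<in>U. dg u Y)"
  using assms by (simp add: rho_def ne_Un sum.union_disjoint algebra_simps)

lemma rho_change:
  assumes "\<And>u. u \<in> U \<Longrightarrow> wt p' q' u \<ge> wt p q u - r u"
  shows "rho p' q' U \<ge> rho p q U - (\<Sum>u\<in>U. r u)"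
proof -
  have "(\<Sum>u\<in>U. wt p' q' u) \<ge> (\<Sum>u\<in>U. wt p q u - r u)"
    using assms by (rule sum_mono)
  then show ?thesis by (simp add: rho_def sum_subtractf)
qed

lemma gq_le: "q \<le> 4 \<Longrightarrow> gq q \<le> 6"
  by (auto simp: gq_def)

lemma gq_dec: "gq (q - 1) \<ge> gq q - 3"
  by (auto simp: gq_def)

text \<open>If the clause about \<open>q = 0\<close> fails at \<open>v\<close>, then
  \<open>v\<close> together with \<open>p v\<close> offending neighbours has potential at most
  \<open>(4 * p v - 3) + 5 * p v - 9 * p v = -3\<close>. This is weaker than -6, but the set has at
  most three vertices.\<close>

lemma not_admissible_cases:
  assumes "finite V" and bd: "\<And>v. v \<in> V \<Longrightarrow> p v \<le> 2 \<and> q v \<le> 4"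
    and na: "\<not> admissible V p q"
  obtains U where "U \<subseteq> V" "U \<noteq> {}" "rho p q U \<le> - 6"
    | U where "U \<subseteq> V" "U \<noteq> {}" "rho p q U \<le> - 3" "card U \<le> 3" "\<And>u. u \<in> U \<Longrightarrow> q u = 0"
proof (cases "\<exists>U\<subseteq>V. rho p q U < - 5")
  case True
  then obtain U where U: "U \<subseteq> V" "rho p q U < - 5" by blast
  then have "U \<noteq> {}" by auto
  with U show thesis by (intro that(1)[of U]) auto
next
  case False
  then have "\<forall>U. U \<subseteq> V \<longrightarrow> - 5 \<le> rho p q U" by (meson not_le)
  with na bd obtain v where v: "v \<in> V" "q v = 0" "\<not> card {u \<in> V. adj v u \<and> q u = 0} < p v"
    unfolding admissible_def by blast
  from v(3) have v3: "p v \<le> card {u \<in> V. adj v u \<and> q u = 0}" by simp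
  then obtain T where T: "T \<subseteq> {u \<in> V. adj v u \<and> q u = 0}" "card T = p v"
    using obtain_subset_with_card_n[OF v3] by blast
  have finT: "finite T" by (rule finite_subset[OF T(1)]) (use \<open>finite V\<close> in simp)
  have vT: "v \<notin> T" using T by auto
  have "nbs v T = T" using T by (auto simp: nbs_def)
  then have dT: "dg v T = p v" using T by (simp add: dg_def)
  have "(\<Sum>u\<in>T. wt p q u) \<le> (\<Sum>u\<in>T. 5)"
    using T bd by (intro sum_mono) (force simp: wt_def gq_def)
  then have "rho p q T \<le> 5 * int (p v)" using T by (simp add: rho_def)
  then have "rho p q (insert v T) \<le> - 3"
    using finT vT dT v by (simp add: rho_insert wt_def gq_def)
  moreover have "card (insert v T) \<le> 3" using T finT vT bd[OF v(1)] by simp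
  moreover have "u \<in> insert v T \<Longrightarrow> q u = 0" for u using T v by auto
  ultimately show thesis using v T by (intro that(2)[of "insert v T"]) auto
qed

lemma admissible_subset:
  assumes "admissible V p q" "finite V" "U \<subseteq> V"
  shows "admissible U p q"
proof -
  have "card {u \<in> U. adj v u \<and> q u = 0} \<le> card {u \<in> V. adj v u \<and> q u = 0}" for v
    using assms by (intro card_mono) auto
  then have "v \<in> U \<Longrightarrow> q v = 0 \<Longrightarrow> card {u \<in> U. adj v u \<and> q u = 0} < p v" for v
    using assms order_le_less_trans[of _ "card {u \<in> V. adj v u \<and> q u = 0}" "p v"]
    unfolding admissible_def by blast
  then show ?thesis using assms(1,3) unfolding admissible_def by (simp add: subset_iff)
qed

lemma valid_mono:
  assumes "valid V p' q' c" "\<And>v. v \<in> V \<Longrightarrow> p' v \<le> p v \<and> q' v \<le> q v"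
  shows "valid V p q c"
  unfolding valid_def
proof
  fix v assume "v \<in> V"
  then have "card (same c (c v) V v) < cap p' q' (c v) v" "p' v \<le> p v \<and> q' v \<le> q v"
    using assms(1) assms(2)[OF \<open>v \<in> V\<close>] by (simp_all add: valid_def)
  then show "card (same c (c v) V v) < cap p q (c v) v"
    by (cases "c v") (simp_all add: cap_def)
qed

end

section \<open>Minimal counterexamples: potential of proper subsets\<close>

locale min_counterexample = simple_edges E for E :: "'a set set" +
  fixes V :: "'a set" and p q :: "'a \<Rightarrow> nat"
  assumes fin: "finite V"
    and adm: "admissible V p q"
    and nocol: "\<And>c. \<not> valid V p q c"
    and IH: "\<And>R p' q'. R \<subset> V \<Longrightarrow> admissible R p' q' \<Longrightarrow> \<exists>c. valid R p' q' c"
begin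

lemma fin_sub [intro]: "U \<subseteq> V \<Longrightarrow> finite U"
  using fin finite_subset by blast

lemma p_le: "v \<in> V \<Longrightarrow> p v \<le> 2" and q_le: "v \<in> V \<Longrightarrow> q v \<le> 4"
  using adm by (auto simp: admissible_def)

lemma rho_ge_minus5: "U \<subseteq> V \<Longrightarrow> rho p q U \<ge> - 5"
  using adm by (auto simp: admissible_def)

lemma IH_valid: "R \<subset> V \<Longrightarrow> \<exists>c. valid R p q c"
  using IH admissible_subset[OF adm fin] by (meson psubset_imp_subset)

text \<open>Without such an edge, colourings of \<open>Y\<close> and of \<open>V - Y\<close> would
  combine into one of \<open>V\<close>.\<close>

lemma crossing_edge:
  assumes "Y \<subset> V" "Y \<noteq> {}"
  obtains y v where "y \<in> Y" "v \<in> V - Y" "adj y v"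
proof (rule ccontr)
  assume "\<not> thesis"
  with that have noadj: "\<not> adj y v" if "y \<in> Y" "v \<in> V - Y" for y v
    using \<open>y \<in> Y\<close> \<open>v \<in> V - Y\<close> by blast
  obtain c where c: "valid Y p q c" using IH_valid assms by blast
  have "V - Y \<subset> V" using assms by blast
  then obtain d where d: "valid (V - Y) p q d" using IH_valid by blast
  define h where "h u = (if u \<in> Y then c u else d u)" for u
  have "same h b V u = same c b Y u" if "u \<in> Y" for u b
    using that noadj assms by (auto simp: same_def h_def)
  moreover have "same h b V u = same d b (V - Y) u" if "u \<in> V - Y" for u b
    using that noadj assms by (auto simp: same_def h_def adj_sym[of u])
  ultimately have "valid V p q h"
    using c d assms by (auto simp: valid_def h_def)
  then show False using nocol by blast
qed

text \<open>Colour \<open>Y\<close> first and forbid every outer vertex the colours it sees in \<open>Y\<close>.  The set \<open>U\<close>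
  witnesses that the rest is then inadmissible, and \<open>t\<close> is its potential after the changes.  If
  \<open>y\<close> is \<open>True\<close> or not yet saturated, the restriction of \<open>v\<close> costs less than the edge \<open>yv\<close>.\<close>

lemma kill:
  assumes Y: "Y \<subset> V" "valid Y p q c" and y: "y \<in> Y" and v: "v \<in> V - Y" and yv: "adj y v"
    and sl: "sl \<longleftrightarrow> c y \<or> card (same c False Y y) + 1 < q y"
  obtains U t where "U \<subseteq> V - Y" "U \<noteq> {}" "t \<le> - 3"
    "rho p q (Y \<union> U) \<le> rho p q Y + t - (if v \<in> U \<and> sl then 1 else 0)"
    "t \<le> - 6 \<or> card U \<le> 3 \<and> ((\<forall>u\<in>Y. c u) \<longrightarrow> (\<forall>u\<in>U. q u = 0))"
proof -
  define W where "W = V - Y"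
  have finY: "finite Y" and finW: "finite W" using Y fin by (auto simp: W_def)
  \<comment> \<open>An outer vertex loses every colour it sees in \<open>Y\<close>, so it cannot
    disturb the colouring of \<open>Y\<close>. The exception is \<open>v\<close> when
    \<open>y\<close> is \<open>False\<close> with a place to spare: this neighbour only lowers
    \<open>q v\<close> by one.\<close>
  define sp where "sp u \<longleftrightarrow> u = v \<and> sl \<and> \<not> c y" for u
  define p' where "p' u = (if same c True Y u = {} then p u else 0)" for u
  define q' where "q' u = (if same c False Y u - (if sp u then {y} else {}) \<noteq> {} then 0
    else if sp u then q u - 1 else q u)" for u
  have notval: "\<not> valid W p' q' d" for d
  proof
    assume d: "valid W p' q' d"
    define h where "h u = (if u \<in> Y then c u else d u)" for u
    have capd: "card (same d (d w) W w) < cap p' q' (d w) w" if "w \<in> W" for w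
      using d that by (auto simp: valid_def)
    have Tw: "same c True Y w = {}" if "w \<in> W" "d w" for w
      using capd[OF that(1)] that by (auto simp: cap_def p'_def split: if_splits)
    have Fw: "same c False Y w \<subseteq> (if sp w then {y} else {})" if "w \<in> W" "\<not> d w" for w
      using capd[OF that(1)] that by (auto simp: cap_def q'_def split: if_splits)
    have "card (same h (h u) V u) < cap p q (h u) u" if u: "u \<in> V" for u
    proof (cases "u \<in> Y")
      case True
      have "same h (h u) V u \<subseteq> same c (c u) Y u \<union> {w \<in> W. adj u w \<and> d w = c u}"
        using True by (auto simp: same_def h_def W_def)
      moreover have "{w \<in> W. adj u w \<and> d w = c u} \<subseteq> (if sp v \<and> u = y then {v} else {})"
      proof
        fix w assume w: "w \<in> {w \<in> W. adj u w \<and> d w = c u}"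
        then have uw: "u \<in> same c (d w) Y w" using True by (auto simp: same_def adj_sym)
        show "w \<in> (if sp v \<and> u = y then {v} else {})"
        proof (cases "d w")
          case True
          then show ?thesis using Tw[of w] w uw by auto
        next
          case False
          have "same c False Y w \<subseteq> (if sp w then {y} else {})" using Fw[of w] False w by blast
          then have "u \<in> (if sp w then {y} else {})" using False uw by (metis (full_types) subsetD)
          then show ?thesis by (auto simp: sp_def split: if_splits)
        qed
      qed
      ultimately have sub: "same h (h u) V u \<subseteq> same c (c u) Y u \<union> (if sp v \<and> u = y then {v} else {})"
        by blast
      have "card (same h (h u) V u) \<le> card (same c (c u) Y u \<union> (if sp v \<and> u = y then {v} else {}))"
        using sub finY by (intro card_mono) auto
      also have "\<dots> \<le> card (same c (c u) Y u) + (if sp v \<and> u = y then 1 else 0)"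
        using card_Un_le[of "same c (c u) Y u" "{v}"] by auto
      also have "\<dots> < cap p q (c u) u"
        using Y True sl by (auto simp: valid_def sp_def cap_def)
      finally show ?thesis using True by (simp add: h_def)
    next
      case False
      then have uW: "u \<in> W" using u by (simp add: W_def)
      have sub: "same h (h u) V u \<subseteq> same d (d u) W u \<union> same c (d u) Y u"
        using False by (auto simp: same_def h_def W_def)
      have "card (same h (h u) V u) \<le> card (same d (d u) W u \<union> same c (d u) Y u)"
        using sub finY finW by (intro card_mono) auto
      also have "\<dots> \<le> card (same d (d u) W u) + card (same c (d u) Y u)" by (rule card_Un_le)
      also have "\<dots> < cap p q (d u) u"
      proof (cases "d u")
        case True
        then show ?thesis using Tw[OF uW] capd[OF uW] by (auto simp: cap_def p'_def)
      next
        case False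
        have "card (same c False Y u) \<le> card (if sp u then {y} else {})"
          using Fw[OF uW False] by (intro card_mono) auto
        then show ?thesis using False Fw[OF uW False] capd[OF uW]
          by (auto simp: cap_def q'_def split: if_splits)
      qed
      finally show ?thesis using False by (simp add: h_def)
    qed
    then have "valid V p q h" by (auto simp: valid_def)
    then show False using nocol by blast
  qed
  have "W \<subset> V" using y Y by (auto simp: W_def)
  then have na: "\<not> admissible W p' q'" using IH notval by blast
  have bd: "p' u \<le> 2 \<and> q' u \<le> 4" if "u \<in> W" for u
    using p_le[of u] q_le[of u] that by (auto simp: p'_def q'_def W_def)
  define r where "r u = 9 * int (dg u Y) - (if u = v then if sl then 1 else 0 else 0)" for u
  \<comment> \<open>A lost colour costs at most 8 or 9 and is paid by an edge to a vertex of
    \<open>Y\<close> with that colour. At \<open>v\<close> one unit remains if \<open>sl\<close>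
    holds: either a \<open>True\<close> edge pays 9 for a loss of 8, or the loss in the second
    capacity is at most 3, or a second \<open>False\<close> edge pays as well.\<close>
  have wt': "wt p' q' u \<ge> wt p q u - r u" if "u \<in> W" for u
  proof -
    have nb: "nbs u Y = same c True Y u \<union> same c False Y u"
      by (auto simp: nbs_def same_def)
    have dgu: "dg u Y = card (same c True Y u) + card (same c False Y u)"
      unfolding dg_def nb using finY by (intro card_Un_disjoint) (auto simp: same_def)
    have p1: "p' u = p u \<or> card (same c True Y u) \<ge> 1 \<and> p' u = 0"
      using finY by (auto simp: p'_def Suc_le_eq card_gt_0_iff)
    have ymem: "y \<in> same c (c y) Y v" using y yv by (simp add: same_def adj_sym)
    have q1: "if sp u then card (same c False Y u) \<ge> 2 \<and> q' u = 0
        \<or> card (same c False Y u) \<ge> 1 \<and> q' u = q u - 1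
      else q' u = q u \<or> card (same c False Y u) \<ge> 1 \<and> q' u = 0"
    proof (cases "sp u")
      case True
      then have yF: "y \<in> same c False Y u" using ymem by (auto simp: sp_def)
      then have c1: "card (same c False Y u) \<ge> 1"
        using finY card_gt_0_iff[of "same c False Y u"] by force
      show ?thesis
      proof (cases "same c False Y u - {y} = {}")
        case True
        then show ?thesis using c1 \<open>sp u\<close> by (auto simp: q'_def)
      next
        case False
        then have "card (same c False Y u - {y}) \<ge> 1"
          using finY card_gt_0_iff[of "same c False Y u - {y}"] by force
        then have "card (same c False Y u) \<ge> 2" using yF finY by simp
        then show ?thesis using False \<open>sp u\<close> by (auto simp: q'_def)
      qed
    next
      case False
      then show ?thesis using finY by (auto simp: q'_def Suc_le_eq card_gt_0_iff)
    qed
    have p2: "4 * int (p u) \<le> 8" using p_le[of u] that by (simp add: W_def)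
    have q2: "gq (q u) \<le> 6" using q_le[of u] gq_le that by (simp add: W_def)
    have q3: "gq (q u - 1) \<ge> gq (q u) - 3" "gq 0 = - 3" using gq_dec by (auto simp: gq_def)
    have yT: "u = v \<Longrightarrow> c y \<Longrightarrow> card (same c True Y u) \<ge> 1"
      using ymem finY card_gt_0_iff[of "same c True Y u"] by force
    show ?thesis
    proof (cases "sp u")
      case True
      then have "u = v" "sl" by (auto simp: sp_def)
      have "r u = 9 * int (dg u Y) - 1" using \<open>u = v\<close> \<open>sl\<close> by (simp add: r_def)
      then show ?thesis using p1 q1 True p2 q2 q3 unfolding wt_def dgu by auto
    next
      case False
      then have "u = v \<Longrightarrow> sl \<Longrightarrow> c y" by (auto simp: sp_def)
      then show ?thesis using p1 q1 False p2 q2 q3 yT by (auto simp: r_def wt_def dgu)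
    qed
  qed
  have drop: "rho p q (Y \<union> U) \<le> rho p q Y + rho p' q' U - (if v \<in> U \<and> sl then 1 else 0)"
    if "U \<subseteq> W" for U
  proof -
    have finU: "finite U" using that finW finite_subset by blast
    have "(\<Sum>u\<in>U. r u) = 9 * int (\<Sum>u\<in>U. dg u Y) - (if v \<in> U \<and> sl then 1 else 0)"
      using finU by (simp add: r_def sum_subtractf sum_distrib_left)
    moreover have "rho p' q' U \<ge> rho p q U - (\<Sum>u\<in>U. r u)"
      by (rule rho_change) (use wt' that in blast)
    moreover have "rho p q (Y \<union> U) = rho p q Y + rho p q U - 9 * int (\<Sum>u\<in>U. dg u Y)"
      using that finU finY by (intro rho_Un) (auto simp: W_def)
    ultimately show ?thesis by linarith
  qed
  have q'T: "q' u = q u" if "\<forall>u\<in>Y. c u" for u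
    using that y by (auto simp: q'_def sp_def same_def)
  show thesis
  proof (rule not_admissible_cases[OF finW bd na])
    fix U assume "U \<subseteq> W" "U \<noteq> {}" "rho p' q' U \<le> - 6"
    then show thesis using drop[of U] by (intro that[of U "rho p' q' U"]) (auto simp: W_def)
  next
    fix U assume "U \<subseteq> W" "U \<noteq> {}" "rho p' q' U \<le> - 3" "card U \<le> 3" "\<And>u. u \<in> U \<Longrightarrow> q' u = 0"
    then show thesis using drop[of U] q'T by (intro that[of U "rho p' q' U"]) (auto simp: W_def)
  qed
qed

text \<open>\<open>kill\<close> enlarges \<open>Y\<close> by \<open>U\<close> and the potential
  drops by at least 3. The enlarged set has potential at least -5 if it is \<open>V\<close>, and at
  least -2 by induction otherwise.\<close>

lemma rho_ge_minus2:
  assumes "Y \<subset> V" "Y \<noteq> {}"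
  shows "rho p q Y \<ge> - 2"
  using assms
proof (induction "card (V - Y)" arbitrary: Y rule: less_induct)
  case less
  obtain c where c: "valid Y p q c" using IH_valid less.prems by blast
  obtain y v where yv: "y \<in> Y" "v \<in> V - Y" "adj y v" using crossing_edge less.prems by blast
  obtain U t where U: "U \<subseteq> V - Y" "U \<noteq> {}" "t \<le> - 3"
    "rho p q (Y \<union> U) \<le> rho p q Y + t"
    by (rule kill[OF less.prems(1) c yv refl]) (smt (verit))
  show ?case
  proof (cases "Y \<union> U = V")
    case True
    then show ?thesis using U rho_ge_minus5[of V] by simp
  next
    case False
    then have "Y \<union> U \<subset> V" using U less.prems by blast
    moreover have "V - (Y \<union> U) \<subset> V - Y" using U by blast
    then have "card (V - (Y \<union> U)) < card (V - Y)" using fin by (intro psubset_card_mono) auto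
    ultimately have "rho p q (Y \<union> U) \<ge> - 2" using less.hyps less.prems by blast
    then show ?thesis using U by simp
  qed
qed

text \<open>Lowering the second capacity of a boundary vertex by one is affordable, so the boundary
  edge can always be assumed to have some slack.\<close>

lemma kill_slack:
  assumes Y: "Y \<subset> V" "Y \<noteq> {}"
  obtains U v t where "U \<subseteq> V - Y" "U \<noteq> {}" "t \<le> - 3" "v \<in> V - Y"
    "rho p q (Y \<union> U) \<le> rho p q Y + t - (if v \<in> U then 1 else 0)"
    "t \<le> - 6 \<or> card U \<le> 3"
proof -
  obtain y v where yv: "y \<in> Y" "v \<in> V - Y" "adj y v" using crossing_edge Y by blast
  define q' where "q' = q(y := q y - 1)"
  have finY: "finite Y" using Y by auto
  have wt': "wt p q' u \<ge> wt p q u - (if u = y then 3 else 0)" for u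
    using gq_dec[of "q y"] by (auto simp: wt_def q'_def)
  have rho': "rho p q' U \<ge> rho p q U - 3" if "U \<subseteq> Y" for U
  proof -
    have "finite U" using that finY finite_subset by blast
    then have "(\<Sum>u\<in>U. if u = y then (3::int) else 0) \<le> 3" by simp
    moreover have "rho p q' U \<ge> rho p q U - (\<Sum>u\<in>U. if u = y then 3 else 0)"
      by (rule rho_change) (rule wt')
    ultimately show ?thesis by linarith
  qed
  have "admissible Y p q'"
  proof (rule ccontr)
    assume na: "\<not> admissible Y p q'"
    have bd: "p u \<le> 2 \<and> q' u \<le> 4" if "u \<in> Y" for u
      using p_le[of u] q_le[of u] that Y by (auto simp: q'_def)
    show False
    proof (rule not_admissible_cases[OF finY bd na])
      fix U assume U: "U \<subseteq> Y" "U \<noteq> {}" "rho p q' U \<le> - 6"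
      then have "U \<subset> V" using Y by blast
      then show False using U rho'[of U] rho_ge_minus2[of U] by linarith
    next
      fix U assume U: "U \<subseteq> Y" "U \<noteq> {}" "rho p q' U \<le> - 3" "card U \<le> 3"
        "\<And>u. u \<in> U \<Longrightarrow> q' u = 0"
      \<comment> \<open>From \<open>q' u = 0\<close> follows \<open>q u \<le> 1\<close>, where
        lowering is free. The set thus keeps its old potential, which exceeds -3.\<close>
      have "wt p q u = wt p q' u" if "u \<in> U" for u
        using U(5)[OF that] by (auto simp: wt_def gq_def q'_def split: if_splits)
      then have "rho p q U = rho p q' U" by (simp add: rho_def)
      moreover have "U \<subset> V" using U Y by blast
      ultimately show False using U rho_ge_minus2[of U] by linarith
    qed
  qed
  then obtain c where c: "valid Y p q' c" using IH Y by blast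
  have c0: "valid Y p q c" by (rule valid_mono[OF c]) (auto simp: q'_def)
  have sl: "c y \<or> card (same c False Y y) + 1 < q y"
    using c yv(1) by (cases "c y") (auto simp: valid_def cap_def q'_def)
  show thesis
    by (rule kill[OF Y(1) c0 yv, of True]) (use sl yv(2) that in \<open>auto\<close>)
qed

text \<open>If \<open>U\<close> is the whole complement it contains \<open>v\<close>, so the drop to
  at least -5 is at least 4; otherwise it is a drop of at least 3 to at least -2.\<close>

lemma rho_ge_minus1:
  assumes "Y \<subset> V" "Y \<noteq> {}"
  shows "rho p q Y \<ge> - 1"
proof -
  obtain U v t where U: "U \<subseteq> V - Y" "U \<noteq> {}" "t \<le> - 3" "v \<in> V - Y"
    "rho p q (Y \<union> U) \<le> rho p q Y + t - (if v \<in> U then 1 else 0)"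
    using kill_slack[OF assms] by metis
  show ?thesis
  proof (cases "U = V - Y")
    case True
    then have "Y \<union> U = V" using assms by blast
    then show ?thesis using U True rho_ge_minus5[of V] by simp
  next
    case False
    then have "Y \<union> U \<subset> V" using U assms by blast
    then have "rho p q (Y \<union> U) \<ge> - 2" using rho_ge_minus2 assms by blast
    then show ?thesis using U by (simp split: if_splits)
  qed
qed

text \<open>If \<open>U\<close> is the whole complement, it is too big for the alternative
  \<open>card U \<le> 3\<close>, so the drop to at least -5 is at least 6 + 1. Otherwise a drop of
  at least 3 ends at a proper subset, with potential at least -1.\<close>

lemma rho_ge_plus2:
  assumes "Y \<subset> V" "Y \<noteq> {}" "card (V - Y) \<ge> 4"
  shows "rho p q Y \<ge> 2"
proof -
  obtain U v t where U: "U \<subseteq> V - Y" "U \<noteq> {}" "t \<le> - 3" "v \<in> V - Y"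
    "rho p q (Y \<union> U) \<le> rho p q Y + t - (if v \<in> U then 1 else 0)"
    "t \<le> - 6 \<or> card U \<le> 3"
    using kill_slack[OF assms(1,2)] by metis
  show ?thesis
  proof (cases "U = V - Y")
    case True
    then have "Y \<union> U = V" using assms by blast
    then show ?thesis using U True assms rho_ge_minus5[of V] by auto
  next
    case False
    then have "Y \<union> U \<subset> V" using U assms by blast
    then have "rho p q (Y \<union> U) \<ge> - 1" using rho_ge_minus1 assms by blast
    then show ?thesis using U by (simp split: if_splits)
  qed
qed

section \<open>Vertices with second capacity at most 1\<close>

lemma rho_single: "rho p q {v} = wt p q v"
  using rho_insert[of "{}" v p q] by simp

lemma rho_pair: "u \<noteq> v \<Longrightarrow> adj u v \<Longrightarrow> rho p q {u, v} = wt p q u + wt p q v - 9"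
  using rho_insert[of "{v}" u p q] rho_single[of v] dg_insert[of "{}" v u] by simp

lemma validity: "v \<in> V \<Longrightarrow> q v = 0 \<Longrightarrow> card {u \<in> V. adj v u \<and> q u = 0} < p v"
  using adm by (auto simp: admissible_def)

lemma not_singleton: "V \<noteq> {v}"
proof
  assume V: "V = {v}"
  have "same c b V v = {}" for c b using V by (auto simp: same_def)
  then have "valid V p q (\<lambda>_. p v > 0)"
    using V validity[of v] by (cases "p v > 0") (auto simp: valid_def cap_def)
  then show False using nocol by blast
qed

text \<open>A proper \<open>Y \<union> U\<close> would have potential at most 1 - 3 = -2, so
  \<open>U\<close> is the whole complement. Then \<open>t \<le> -6\<close> would push
  \<open>V\<close> to -6, which leaves only the alternative with \<open>q = 0\<close> on
  \<open>U\<close>.\<close>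

lemma kill_all_True:
  assumes Y: "Y \<subset> V" "Y \<noteq> {}" and c: "valid Y p q (\<lambda>_. True)" and r: "rho p q Y \<le> 1"
  shows "\<forall>u\<in>V - Y. q u = 0"
proof -
  obtain y w where yw: "y \<in> Y" "w \<in> V - Y" "adj y w" using crossing_edge Y by blast
  obtain U t where U: "U \<subseteq> V - Y" "U \<noteq> {}" "t \<le> - 3"
    "rho p q (Y \<union> U) \<le> rho p q Y + t - (if w \<in> U then 1 else 0)"
    "t \<le> - 6 \<or> (\<forall>u\<in>U. q u = 0)"
    by (rule kill[OF Y(1) c yw, of True]) auto
  have UY: "U = V - Y"
  proof (rule ccontr)
    assume "U \<noteq> V - Y"
    then have "Y \<union> U \<subset> V" using U Y by blast
    then have "rho p q (Y \<union> U) \<ge> - 1" using rho_ge_minus1 Y by blast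
    then show False using U r by (simp split: if_splits)
  qed
  then have "Y \<union> U = V" using Y by blast
  then have "t > - 6" using U r UY yw rho_ge_minus5[of V] by simp
  then show ?thesis using U UY by simp
qed

text \<open>With \<open>p v = 0\<close> the vertex alone has potential -3. With
  \<open>p v = 1\<close> it has potential 1 and can be \<open>True\<close>, so all others have
  \<open>q = 0\<close>, and an edge \<open>vw\<close> gives at most 1 + 5 - 9 = -3. Hence
  \<open>V = {v, w}\<close>, where \<open>v\<close> can be \<open>False\<close> and \<open>w\<close>
  \<open>True\<close>.\<close>

lemma low_q_p_eq_2:
  assumes v: "v \<in> V" "q v \<le> 1"
  shows "p v = 2"
proof (rule ccontr)
  assume "p v \<noteq> 2"
  then have pv: "p v = 0 \<or> p v = 1" using p_le[OF v(1)] by auto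
  have Y: "{v} \<subset> V" "{v} \<noteq> {}" using v not_singleton[of v] by auto
  have "p v \<noteq> 0" using rho_ge_minus1[OF Y] v by (auto simp: rho_single wt_def gq_def)
  with pv have pv: "p v = 1" by simp
  have "valid {v} p q (\<lambda>_. True)" using pv by (auto simp: valid_def same_def cap_def)
  moreover have "rho p q {v} \<le> 1" using v pv by (simp add: rho_single wt_def gq_def)
  ultimately have q0: "\<forall>u\<in>V - {v}. q u = 0" using kill_all_True[OF Y] by blast
  obtain w where w: "w \<in> V - {v}" "adj v w" using crossing_edge[OF Y] by blast
  have "rho p q {v, w} \<le> - 3"
    using w v pv q0 p_le[of w] by (subst rho_pair) (auto simp: wt_def gq_def)
  then have V: "V = {v, w}" using rho_ge_minus1[of "{v, w}"] w v by force
  have pw: "p w > 0" using validity[of w] q0 w by force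
  have "q v \<noteq> 0"
  proof
    assume "q v = 0"
    then have "card {u \<in> V. adj v u \<and> q u = 0} < 1" using validity[OF v(1)] pv by simp
    moreover have "w \<in> {u \<in> V. adj v u \<and> q u = 0}" using w q0 by auto
    ultimately show False using fin by (auto simp: card_eq_0_iff)
  qed
  moreover have "same (\<lambda>u. u = w) b V u = {}" if "b = (u = w)" "u \<in> V" for u b
    using that V w by (auto simp: same_def)
  ultimately have "valid V p q (\<lambda>u. u = w)"
    using pw V w by (auto simp: valid_def cap_def)
  then show False using nocol by blast
qed

text \<open>The pair has potential 5 + 5 - 9 = 1 and can be all \<open>True\<close>. So every other
  vertex has \<open>q = 0\<close>, and an adjacent third one brings the potential to at most -3,
  which leaves at most three vertices.\<close>

lemma low_q_not_adjacent:
  assumes a: "a \<in> V" "q a \<le> 1" and b: "b \<in> V" "q b \<le> 1" and ab: "adj a b"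
  shows False
proof -
  have pa: "p a = 2" "p b = 2" using a b low_q_p_eq_2 by auto
  have neq: "a \<noteq> b" using ab by auto
  have rho1: "rho p q {a, b} = 1" using neq ab a b pa by (simp add: rho_pair wt_def gq_def)
  have val: "valid {a, b} p q (\<lambda>_. True)"
  proof -
    have "same (\<lambda>_. True) True {a, b} a = {b}" "same (\<lambda>_. True) True {a, b} b = {a}"
      using ab by (auto simp: same_def adj_sym)
    then show ?thesis using pa by (simp add: valid_def cap_def)
  qed
  show False
  proof (cases "V = {a, b}")
    case True
    then show ?thesis using val nocol by metis
  next
    case False
    then have Y: "{a, b} \<subset> V" "{a, b} \<noteq> {}" using a b by auto
    have q0: "\<forall>u\<in>V - {a, b}. q u = 0" using kill_all_True[OF Y val] rho1 by simp
    obtain y w where w: "y \<in> {a, b}" "w \<in> V - {a, b}" "adj y w" using crossing_edge[OF Y] by blast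
    have "dg w {a, b} \<ge> 1" using dg_pos[of "{a, b}" y w] w by (auto simp: adj_sym)
    moreover have "wt p q w \<le> 5" using p_le[of w] w q0 by (auto simp: wt_def gq_def)
    moreover have "rho p q (insert w {a, b}) = rho p q {a, b} + wt p q w - 9 * int (dg w {a, b})"
      using w by (intro rho_insert) auto
    ultimately have "rho p q (insert w {a, b}) \<le> - 3" using rho1 by linarith
    then have "\<not> insert w {a, b} \<subset> V" using rho_ge_minus1[of "insert w {a, b}"] by force
    then have V: "V = {a, b, w}" using w a b by blast
    have pV: "p u = 2" if "u \<in> V" for u using that V pa low_q_p_eq_2[of w] q0 w by auto
    \<comment> \<open>A vertex with \<open>q = 1\<close> can be the only \<open>False\<close> one,
      since the other two have \<open>True\<close> capacity 2. If there is none, \<open>y\<close>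
      has two neighbours with \<open>q = 0\<close>, against admissibility.\<close>
    show False
    proof (cases "\<exists>s\<in>V. q s = 1")
      case True
      then obtain s where s: "s \<in> V" "q s = 1" by blast
      have cV: "card V \<le> 3" using V by (simp add: card_insert_if)
      have "card (same (\<lambda>u. u \<noteq> s) (u \<noteq> s) V u) < cap p q (u \<noteq> s) u" if u: "u \<in> V" for u
      proof (cases "u = s")
        case True
        then have "same (\<lambda>u. u \<noteq> s) (u \<noteq> s) V u = {}" by (auto simp: same_def)
        then show ?thesis using True s by (simp add: cap_def)
      next
        case False
        then have "same (\<lambda>u. u \<noteq> s) (u \<noteq> s) V u \<subseteq> V - {u, s}" by (auto simp: same_def)
        then have "card (same (\<lambda>u. u \<noteq> s) (u \<noteq> s) V u) \<le> card (V - {u, s})"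
          using fin by (intro card_mono) auto
        also have "\<dots> = card V - 2" using False u s by (subst card_Diff_subset) auto
        finally show ?thesis using cV False pV[OF u] by (simp add: cap_def)
      qed
      then have "valid V p q (\<lambda>u. u \<noteq> s)" by (auto simp: valid_def)
      then show ?thesis using nocol by blast
    next
      case False
      have all0: "\<forall>u\<in>V. q u = 0"
      proof
        fix u assume u: "u \<in> V"
        have "q w = 0" using q0 w by blast
        then have "q u \<le> 1" using u V a(2) b(2) by auto
        moreover have "q u \<noteq> 1" using False u by blast
        ultimately show "q u = 0" by simp
      qed
      define z where "z = (if y = a then b else a)"
      have z: "z \<in> {a, b}" "adj y z" using w(1) ab adj_sym[of a b] by (auto simp: z_def)
      have "w \<in> {u \<in> V. adj y u \<and> q u = 0}" "z \<in> {u \<in> V. adj y u \<and> q u = 0}"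
        using w z all0 a(1) b(1) by auto
      then have "{w, z} \<subseteq> {u \<in> V. adj y u \<and> q u = 0}" by simp
      then have "card {w, z} \<le> card {u \<in> V. adj y u \<and> q u = 0}" using fin by (intro card_mono) auto
      moreover have "w \<noteq> z" using w(2) z(1) by auto
      moreover have "y \<in> V" using w(1) a(1) b(1) by auto
      ultimately show ?thesis using validity[of y] all0 pV[of y] by auto
    qed
  qed
qed

section \<open>Extending colourings; light vertices\<close>

text \<open>A vertex of \<open>Z\<close> normally takes the colour opposite to its outer neighbour
  \<open>y z\<close>; it can then agree only with \<open>v\<close>, which capacities of at least 2
  permit. The single vertex that \<open>Z0\<close> may contain avoids the colour \<open>i\<close> of
  \<open>v\<close> instead, so it does not count at \<open>v\<close> but may need a free place at
  its outer neighbour.\<close>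

lemma extend:
  assumes v: "v \<in> V" "v \<notin> Z" and Z: "Z \<subseteq> V" and R: "R = V - insert v Z"
    and z: "\<And>z. z \<in> Z \<Longrightarrow> nbs z V = {v, y z} \<and> y z \<in> R \<and> p z = 2 \<and> q z \<ge> 2"
    and c: "valid R p q c"
    and Z0: "Z0 \<subseteq> Z" "\<And>z z'. z \<in> Z0 \<Longrightarrow> z' \<in> Z0 \<Longrightarrow> z = z'"
    and cnt: "card (same c i R v) + card {z \<in> Z - Z0. c (y z) \<noteq> i} < cap p q i v"
    and slx: "\<And>x. x \<in> R \<Longrightarrow> adj v x \<Longrightarrow> c x = i \<Longrightarrow> card (same c i R x) + 1 < cap p q i x"
    and slz: "\<And>z. z \<in> Z0 \<Longrightarrow> c (y z) \<noteq> i \<Longrightarrow>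
      card (same c (\<not> i) R (y z)) + 1 < cap p q (\<not> i) (y z)"
  shows False
proof -
  define h where "h u = (if u = v then i else if u \<in> Z0 then \<not> i
    else if u \<in> Z then \<not> c (y u) else c u)" for u
  have finR: "finite R" and finZ: "finite Z" using R Z fin finite_subset by auto
  have hR: "h u = c u" if "u \<in> R" for u using that R Z0 by (auto simp: h_def)
  have zadj: "adj z u \<longleftrightarrow> u = v \<or> u = y z" if "z \<in> Z" "u \<in> V" for z u
    using z[OF that(1)] that(2) by (auto simp: nbs_def)
  have "card (same h (h u) V u) < cap p q (h u) u" if u: "u \<in> V" for u
  proof -
    consider "u = v" | "u \<in> Z" | "u \<in> R" using u R by blast
    then show ?thesis
    proof cases
      case 1
      have "same h i V v \<subseteq> same c i R v \<union> {z \<in> Z - Z0. c (y z) \<noteq> i}"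
      proof
        fix w assume w: "w \<in> same h i V v"
        then have "w \<in> V" "adj v w" "h w = i" by (auto simp: same_def)
        moreover have "w \<noteq> v" using \<open>adj v w\<close> by auto
        ultimately show "w \<in> same c i R v \<union> {z \<in> Z - Z0. c (y z) \<noteq> i}"
          using hR R by (cases "w \<in> Z") (auto simp: same_def h_def split: if_splits)
      qed
      then have "card (same h i V v) \<le> card (same c i R v \<union> {z \<in> Z - Z0. c (y z) \<noteq> i})"
        using finR finZ by (intro card_mono) auto
      also have "\<dots> \<le> card (same c i R v) + card {z \<in> Z - Z0. c (y z) \<noteq> i}"
        by (rule card_Un_le)
      finally show ?thesis using cnt 1 by (simp add: h_def)
    next
      case 2
      then have uv: "u \<noteq> v" using v by auto
      have yR: "y u \<in> R" using z[OF 2] by simp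
      have "same h (h u) V u \<subseteq> (if u \<in> Z0 then {y u} else {v})"
      proof
        fix w assume w: "w \<in> same h (h u) V u"
        then have wV: "w \<in> V" and "adj u w" and hw: "h w = h u" by (auto simp: same_def)
        then have "w = v \<or> w = y u" using zadj[OF 2 wV] by simp
        then show "w \<in> (if u \<in> Z0 then {y u} else {v})"
          using hw hR[OF yR] 2 uv by (auto simp: h_def)
      qed
      then have "card (same h (h u) V u) \<le> card (if u \<in> Z0 then {y u} else {v})"
        by (intro card_mono) auto
      also have "\<dots> \<le> 1" by simp
      finally show ?thesis using z[OF 2] by (auto simp: cap_def)
    next
      case 3
      have capu: "card (same c (c u) R u) < cap p q (c u) u" using c 3 by (auto simp: valid_def)
      \<comment> \<open>The only new neighbours of \<open>u\<close> that can share its colour: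
        \<open>v\<close> if that colour is \<open>i\<close>, the vertex of \<open>Z0\<close>
        otherwise.\<close>
      define T where "T = (if c u = i then {w. w = v \<and> adj u w} else {w \<in> Z0. y w = u})"
      have sub: "same h (h u) V u \<subseteq> same c (c u) R u \<union> T"
      proof
        fix w assume w: "w \<in> same h (h u) V u"
        then have wV: "w \<in> V" and adj: "adj u w" and hw: "h w = c u"
          using hR[OF 3] by (auto simp: same_def)
        consider "w = v" | "w \<in> Z" | "w \<in> R" using wV R by blast
        then show "w \<in> same c (c u) R u \<union> T"
        proof cases
          case 1
          then show ?thesis using hw adj by (auto simp: T_def h_def)
        next
          case 2
          then have "u = y w" using zadj[OF 2 u] adj 3 R by (auto simp: adj_sym)
          moreover have "w \<noteq> v" using 2 v by auto
          ultimately show ?thesis using hw 2 by (auto simp: T_def h_def split: if_splits)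
        next
          case 3
          then show ?thesis using hw adj hR by (auto simp: same_def)
        qed
      qed
      have "w = w'" if "w \<in> T" "w' \<in> T" for w w'
        using that Z0(2) by (auto simp: T_def split: if_splits)
      then have T1: "T = {} \<or> (\<exists>w. T = {w})" by blast
      have "card (same h (h u) V u) \<le> card (same c (c u) R u \<union> T)"
        using sub finR T1 by (intro card_mono) auto
      also have "\<dots> \<le> card (same c (c u) R u) + card T" by (rule card_Un_le)
      also have "\<dots> < cap p q (c u) u"
      proof (cases "T = {}")
        case True
        then show ?thesis using capu by simp
      next
        case False
        then have "card T = 1" using T1 by auto
        moreover have "card (same c (c u) R u) + 1 < cap p q (c u) u"
        proof (cases "c u = i")
          case True
          then show ?thesis using False slx[OF 3] by (auto simp: T_def adj_sym)
        next
          case ne: False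
          then obtain w where w: "w \<in> Z0" "y w = u" using False by (auto simp: T_def)
          have "c u = (\<not> i)" using ne by auto
          then show ?thesis using slz[OF w(1)] w ne by simp
        qed
        ultimately show ?thesis by simp
      qed
      finally show ?thesis using hR[OF 3] by simp
    qed
  qed
  then have "valid V p q h" by (simp add: valid_def)
  then show False using nocol by blast
qed

definition light :: "'a set" where
  "light = {z \<in> V. p z = 2 \<and> q z \<ge> 2 \<and> dg z V = 2}"

definition other :: "'a \<Rightarrow> 'a \<Rightarrow> 'a" where
  "other v z = (SOME y. nbs z V = {v, y} \<and> y \<noteq> v)"

lemma light_sub: "light \<subseteq> V" and fin_light [simp]: "finite light"
  using fin by (auto simp: light_def)

lemma other:
  assumes "z \<in> light" "v \<in> V" "adj v z"
  shows "nbs z V = {v, other v z}" "other v z \<noteq> v" "other v z \<in> V" "adj z (other v z)"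
proof -
  have "v \<in> nbs z V" "card (nbs z V) = 2"
    using assms by (auto simp: nbs_def light_def dg_def adj_sym)
  then have "\<exists>y. nbs z V = {v, y} \<and> y \<noteq> v" by (auto simp: card_2_iff)
  then have *: "nbs z V = {v, other v z} \<and> other v z \<noteq> v"
    unfolding other_def by (rule someI_ex)
  then show "nbs z V = {v, other v z}" "other v z \<noteq> v" by auto
  then have "other v z \<in> nbs z V" by auto
  then show "other v z \<in> V" "adj z (other v z)" by (auto simp: nbs_def)
qed

lemma extend_light:
  assumes v: "v \<in> V" and Z: "Z \<subseteq> {z \<in> light. adj v z}" and R: "R = V - insert v Z"
    and oth: "\<And>z. z \<in> Z \<Longrightarrow> other v z \<notin> Z"
    and c: "valid R p q c"
    and Z0: "Z0 \<subseteq> Z" "\<And>z z'. z \<in> Z0 \<Longrightarrow> z' \<in> Z0 \<Longrightarrow> z = z'"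
    and cnt: "card (same c i R v) + card {z \<in> Z - Z0. c (other v z) \<noteq> i} < cap p q i v"
    and slx: "\<And>x. x \<in> R \<Longrightarrow> adj v x \<Longrightarrow> c x = i \<Longrightarrow> card (same c i R x) + 1 < cap p q i x"
    and slz: "\<And>z. z \<in> Z0 \<Longrightarrow> c (other v z) \<noteq> i \<Longrightarrow>
      card (same c (\<not> i) R (other v z)) + 1 < cap p q (\<not> i) (other v z)"
  shows False
proof (rule extend[OF v _ _ R _ c Z0 cnt slx slz])
  show "v \<notin> Z" using Z by auto
  show "Z \<subseteq> V" using Z light_sub by auto
  show "nbs z V = {v, other v z} \<and> other v z \<in> R \<and> p z = 2 \<and> 2 \<le> q z" if "z \<in> Z" for z
    using that Z other[of z v] v oth R by (auto simp: light_def)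
qed

text \<open>Colour the rest, then give \<open>v\<close> the colour opposite to its other neighbour
  \<open>a\<close>, and \<open>z\<close> the colour opposite to its own outer neighbour. Of the new
  edges only \<open>vz\<close> can be monochromatic.\<close>

lemma light_not_adjacent:
  assumes "v \<in> light" "z \<in> light" "adj v z"
  shows False
proof -
  have vV: "v \<in> V" "z \<in> V" using assms light_sub by auto
  define a where "a = other z v"
  have a: "nbs v V = {z, a}" "a \<noteq> z" "a \<in> V"
    using other[of v z] assms vV by (auto simp: a_def adj_sym)
  define R where "R = V - insert v {z}"
  obtain c where c: "valid R p q c" using IH_valid[of R] vV by (auto simp: R_def)
  have na: "x = a" if "x \<in> R" "adj v x" for x using that a(1) by (auto simp: R_def nbs_def)
  have same0: "same c (\<not> c a) R v = {}" using na by (auto simp: same_def)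
  have "card {u \<in> {z} - {}. c (other v u) \<noteq> (\<not> c a)} \<le> card {z}" by (intro card_mono) auto
  then have cnt: "card {u \<in> {z} - {}. c (other v u) \<noteq> (\<not> c a)} \<le> 1" by simp
  have "other v z \<noteq> z" using other(4)[of z v] assms vV by auto
  show False
  proof (rule extend_light[OF vV(1) _ R_def _ c])
    show "{z} \<subseteq> {z \<in> light. adj v z}" using assms by simp
    show "\<And>x. x \<in> {z} \<Longrightarrow> other v x \<notin> {z}" using \<open>other v z \<noteq> z\<close> by simp
    show "{} \<subseteq> {z}" by simp
    show "card (same c (\<not> c a) R v) + card {u \<in> {z} - {}. c (other v u) \<noteq> (\<not> c a)}
      < cap p q (\<not> c a) v"
      using cnt same0 assms by (auto simp: cap_def light_def)
    show "\<And>x. x \<in> R \<Longrightarrow> adj v x \<Longrightarrow> c x = (\<not> c a) \<Longrightarrow>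
      card (same c (\<not> c a) R x) + 1 < cap p q (\<not> c a) x"
      using na by blast
  qed simp_all
qed

lemma other_not_light:
  "z \<in> light \<Longrightarrow> v \<in> V \<Longrightarrow> adj v z \<Longrightarrow> other v z \<notin> light"
  using other(4) light_not_adjacent by blast

lemma sum_adj_int:
  assumes "finite U"
  shows "(\<Sum>u\<in>U. if adj v u then k else 0) = k * int (dg v U)"
proof -
  have "(\<Sum>u\<in>U. if adj v u then k else 0) = (\<Sum>u\<in>nbs v U. k)"
    unfolding nbs_def using assms by (rule sum.inter_filter[symmetric])
  then show ?thesis by (simp add: dg_def)
qed

text \<open>Otherwise remove \<open>v\<close>, \<open>z1\<close> and \<open>z2\<close>, forbid
  \<open>True\<close> at the other neighbours of \<open>v\<close>, and reserve a
  \<open>False\<close> place at the outer neighbour \<open>y\<close> of \<open>z1\<close>.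
  Afterwards \<open>v\<close> can be \<open>True\<close> and \<open>z1\<close> \<open>False\<close>;
  only \<open>z2\<close> may then agree with \<open>v\<close>.\<close>

lemma low_q_light_neighbour:
  assumes v: "v \<in> V" "q v \<le> 1" and z: "z1 \<in> light" "z2 \<in> light" "adj v z1" "adj v z2"
  shows "z1 = z2"
proof (rule ccontr)
  assume neq: "z1 \<noteq> z2"
  have zV: "z1 \<in> V" "z2 \<in> V" using z light_sub by auto
  have vz: "v \<notin> {z1, z2}" using z by auto
  define R where "R = V - insert v {z1, z2}"
  define y where "y = other v z1"
  note y1 = other[OF z(1) v(1) z(3), folded y_def]
  have pv: "p v = 2" using low_q_p_eq_2 v by blast
  have yR: "y \<in> R" using y1 z other_not_light[OF z(1) v(1) z(3)] by (auto simp: R_def y_def)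
  define p' where "p' u = (if adj v u then 0 else p u)" for u
  define q' where "q' = q(y := q y - 1)"
  have finR: "finite R" using fin by (simp add: R_def)
  have wt': "wt p' q' u \<ge> wt p q u - ((if adj v u then 8 else 0) + (if u = y then 3 else 0))"
    if "u \<in> R" for u
    using gq_dec[of "q y"] p_le[of u] that by (auto simp: wt_def p'_def q'_def R_def)
  have rho': "rho p' q' U \<ge> rho p q U - 8 * int (dg v U) - (if y \<in> U then 3 else 0)"
    if "U \<subseteq> R" for U
  proof -
    have fU: "finite U" using that finR finite_subset by blast
    have "rho p' q' U \<ge> rho p q U
        - (\<Sum>u\<in>U. (if adj v u then 8 else 0) + (if u = y then 3 else 0))"
      by (rule rho_change) (use wt' that in blast)
    then show ?thesis using fU by (simp add: sum.distrib sum_adj_int)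
  qed
  \<comment> \<open>With \<open>d = dg v U\<close>, adding \<open>v\<close> of weight 5 back shows
    \<open>rho p q U - 8 * d \<ge> -6 + d\<close>. If \<open>y\<close> is in \<open>U\<close> and
    \<open>d > 0\<close>, the further cost 3 is recovered by adding \<open>z1\<close> too: at most
    14 for two edges. The set is still proper, as \<open>z2\<close> is missing.\<close>
  have big: "rho p' q' U \<ge> - 5" if U: "U \<subseteq> R" "U \<noteq> {}" for U
  proof -
    have fU: "finite U" using U finR finite_subset by blast
    have vU: "v \<notin> U" "z1 \<notin> insert v U" using U vz by (auto simp: R_def)
    have sub: "U \<subset> V" "insert v U \<subset> V" "insert z1 (insert v U) \<subset> V"
      using U v zV neq vz by (auto simp: R_def)
    have "rho p q (insert v U) = rho p q U + 5 - 9 * int (dg v U)"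
      using rho_insert[OF fU vU(1)] v pv by (simp add: wt_def gq_def)
    moreover have "rho p q U \<ge> - 1" "rho p q (insert v U) \<ge> - 1"
      "rho p q (insert z1 (insert v U)) \<ge> - 1"
      using rho_ge_minus1 sub U by auto
    moreover have "rho p q (insert z1 (insert v U)) \<le> rho p q (insert v U) - 4" if "y \<in> U"
    proof -
      have "nbs z1 V \<subseteq> nbs z1 (insert v U)" using y1(1) that by (auto simp: nbs_def)
      then have "dg z1 (insert v U) \<ge> card {v, y}"
        unfolding dg_def using y1(1) fU by (metis card_mono finite_insert finite_nbs)
      then have "dg z1 (insert v U) \<ge> 2" using y1(2) by auto
      moreover have "wt p q z1 \<le> 14"
        using z(1) gq_le q_le[OF zV(1)] by (auto simp: wt_def light_def)
      ultimately show ?thesis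
        using rho_insert[OF _ vU(2), of p q] fU by simp
    qed
    ultimately show ?thesis using rho'[OF U(1)]
      by (cases "dg v U = 0") (auto split: if_splits)
  qed
  have "admissible R p' q'"
  proof (rule ccontr)
    assume na: "\<not> admissible R p' q'"
    have bd: "p' u \<le> 2 \<and> q' u \<le> 4" if "u \<in> R" for u
      using p_le[of u] q_le[of u] that by (auto simp: p'_def q'_def R_def)
    show False
    proof (rule not_admissible_cases[OF finR bd na])
      fix U assume "U \<subseteq> R" "U \<noteq> {}" "rho p' q' U \<le> - 6"
      then show False using big[of U] by simp
    next
      fix U assume U: "U \<subseteq> R" "U \<noteq> {}" "rho p' q' U \<le> - 3" "\<And>u. u \<in> U \<Longrightarrow> q' u = 0"
      \<comment> \<open>Here \<open>q u \<le> 1\<close>, so \<open>u\<close> is not adjacent to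
        \<open>v\<close> and keeps its \<open>p\<close>, while lowering \<open>q\<close> is
        free.\<close>
      have "wt p' q' u = wt p q u" if "u \<in> U" for u
      proof -
        have "q' u = 0" "u \<in> V" using U that by (auto simp: R_def)
        then have "q u \<le> 1" by (auto simp: q'_def split: if_splits)
        moreover from this have "\<not> adj v u" using low_q_not_adjacent v \<open>u \<in> V\<close> by blast
        ultimately show ?thesis using \<open>q' u = 0\<close> by (auto simp: wt_def p'_def gq_def)
      qed
      then have "rho p' q' U = rho p q U" by (simp add: rho_def)
      moreover have "U \<subset> V" using U v by (auto simp: R_def)
      ultimately show False using rho_ge_minus1[of U] U by simp
    qed
  qed
  moreover have "R \<subset> V" using v by (auto simp: R_def)
  ultimately obtain c where c': "valid R p' q' c" using IH by blast
  then have c: "valid R p q c" by (rule valid_mono) (auto simp: p'_def q'_def)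
  have cap': "card (same c (c u) R u) < cap p' q' (c u) u" if "u \<in> R" for u
    using c' that by (auto simp: valid_def)
  have F: "\<not> c u" if "u \<in> R" "adj v u" for u
    using cap'[OF that(1)] that by (auto simp: cap_def p'_def)
  have cy: "card (same c False R y) + 1 < q y" if "\<not> c y"
    using cap'[OF yR] that by (auto simp: cap_def q'_def)
  have "card {z \<in> {z1, z2} - {z1}. c (other v z) \<noteq> True} \<le> card {z2}" by (intro card_mono) auto
  moreover have "same c True R v = {}" using F by (auto simp: same_def)
  ultimately have "card (same c True R v) + card {z \<in> {z1, z2} - {z1}. c (other v z) \<noteq> True}
    < cap p q True v" using pv by (simp add: cap_def)
  show False
  proof (rule extend_light[OF v(1) _ R_def _ c])
    show "{z1, z2} \<subseteq> {z \<in> light. adj v z}" using z by simp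
    show "\<And>x. x \<in> {z1, z2} \<Longrightarrow> other v x \<notin> {z1, z2}"
      using other_not_light[OF z(1) v(1) z(3)] other_not_light[OF z(2) v(1) z(4)] z by auto
    show "{z1} \<subseteq> {z1, z2}" by simp
    show "card (same c True R v) + card {z \<in> {z1, z2} - {z1}. c (other v z) \<noteq> True}
      < cap p q True v" by fact
    show "\<And>x. x \<in> R \<Longrightarrow> adj v x \<Longrightarrow> c x = True \<Longrightarrow> card (same c True R x) + 1 < cap p q True x"
      using F by blast
    show "\<And>z. z \<in> {z1} \<Longrightarrow> c (other v z) \<noteq> True \<Longrightarrow>
      card (same c (\<not> True) R (other v z)) + 1 < cap p q (\<not> True) (other v z)"
      using cy by (auto simp: y_def cap_def)
  qed simp_all
qed

text \<open>Otherwise \<open>v\<close> has at most one neighbour, a light one, and can be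
  \<open>True\<close> in an extension of any colouring of the rest.\<close>

lemma low_q_heavy_neighbour:
  assumes v: "v \<in> V" "q v \<le> 1"
  shows "dg v (V - light) \<ge> 1"
proof (rule ccontr)
  assume "\<not> dg v (V - light) \<ge> 1"
  have no: "\<not> adj v u" if "u \<in> V - light" for u
  proof
    assume "adj v u"
    then have "dg v (V - light) \<ge> 1" using that fin by (intro dg_pos[of _ u]) auto
    then show False using \<open>\<not> dg v (V - light) \<ge> 1\<close> by simp
  qed
  define Z where "Z = {z \<in> light. adj v z}"
  define R where "R = V - insert v Z"
  have "R \<subset> V" using v by (auto simp: R_def)
  then obtain c where c: "valid R p q c" using IH_valid by blast
  have noR: "\<not> adj v u" if "u \<in> R" for u using that no by (auto simp: R_def Z_def)
  have "z = z'" if "z \<in> Z" "z' \<in> Z" for z z'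
    using that low_q_light_neighbour[OF v, of z z'] by (auto simp: Z_def)
  then have "Z = {} \<or> (\<exists>z. Z = {z})" by blast
  then have "card Z \<le> 1" "finite Z" by auto
  moreover from this have "card {z \<in> Z - {}. c (other v z) \<noteq> True} \<le> card Z"
    by (intro card_mono) auto
  moreover have "same c True R v = {}" using noR by (auto simp: same_def)
  ultimately have "card (same c True R v) + card {z \<in> Z - {}. c (other v z) \<noteq> True}
    < cap p q True v" using low_q_p_eq_2[OF v] by (simp add: cap_def)
  show False
  proof (rule extend_light[OF v(1) _ R_def _ c])
    show "Z \<subseteq> {z \<in> light. adj v z}" by (simp add: Z_def)
    show "\<And>x. x \<in> Z \<Longrightarrow> other v x \<notin> Z" using other_not_light v(1) by (simp add: Z_def)
    show "card (same c True R v) + card {z \<in> Z - {}. c (other v z) \<noteq> True}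
      < cap p q True v" by fact
    show "\<And>x. x \<in> R \<Longrightarrow> adj v x \<Longrightarrow> c x = True \<Longrightarrow> card (same c True R x) + 1 < cap p q True x"
      using noR by blast
  qed simp_all
qed

section \<open>Lower bounds on degrees\<close>

text \<open>With four vertices removed, every remaining nonempty set has potential at least 2, which
  pays 4 + 3 for lowering both capacities of \<open>s\<close>. So \<open>s\<close> has a free place
  whichever colour it gets. On a set with all \<open>q' = 0\<close> the second capacity is lowered
  for free, and 2 - 4 is still above -3.\<close>

lemma reserve_both:
  assumes S: "S \<subseteq> V" "card S \<ge> 4" and R: "R = V - S" and s: "s \<in> R"
  obtains c where "valid R p q c" "card (same c (c s) R s) + 1 < cap p q (c s) s"
proof -
  define p' where "p' = p(s := p s - 1)"
  define q' where "q' = q(s := q s - 1)"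
  have finR: "finite R" using fin R by simp
  have "card S \<noteq> 0" using S by simp
  then have "S \<noteq> {}" by auto
  then have RV: "R \<subset> V" using S R by blast
  have ge2: "rho p q U \<ge> 2" if "U \<subseteq> R" "U \<noteq> {}" for U
  proof (rule rho_ge_plus2)
    show "U \<subset> V" using that RV by blast
    have "S \<subseteq> V - U" using that R S by blast
    then have "card S \<le> card (V - U)" using fin by (intro card_mono) auto
    then show "card (V - U) \<ge> 4" using S by simp
  qed fact
  have sumle: "(\<Sum>u\<in>U. if u = s then k else 0) \<le> k" if "U \<subseteq> R" "0 \<le> (k::int)" for U k
    using that finite_subset[OF that(1) finR] by simp
  have wt7: "wt p' q' u \<ge> wt p q u - (if u = s then 7 else 0)" for u
    using gq_dec[of "q s"] by (auto simp: wt_def p'_def q'_def)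
  have wt4: "wt p' q' u \<ge> wt p q u - (if u = s then 4 else 0)" if "q' u = 0" for u
    using that by (auto simp: wt_def p'_def q'_def gq_def split: if_splits)
  have "admissible R p' q'"
  proof (rule ccontr)
    assume na: "\<not> admissible R p' q'"
    have bd: "p' u \<le> 2 \<and> q' u \<le> 4" if "u \<in> R" for u
      using p_le[of u] q_le[of u] that R by (auto simp: p'_def q'_def)
    show False
    proof (rule not_admissible_cases[OF finR bd na])
      fix U assume U: "U \<subseteq> R" "U \<noteq> {}" "rho p' q' U \<le> - 6"
      have "rho p' q' U \<ge> rho p q U - (\<Sum>u\<in>U. if u = s then 7 else 0)"
        by (rule rho_change) (rule wt7)
      then show False using U ge2[of U] sumle[of U 7] by linarith
    next
      fix U assume U: "U \<subseteq> R" "U \<noteq> {}" "rho p' q' U \<le> - 3" "\<And>u. u \<in> U \<Longrightarrow> q' u = 0"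
      have "rho p' q' U \<ge> rho p q U - (\<Sum>u\<in>U. if u = s then 4 else 0)"
        by (rule rho_change) (rule wt4[OF U(4)])
      then show False using U ge2[of U] sumle[of U 4] by linarith
    qed
  qed
  then obtain c where c: "valid R p' q' c" using IH RV by blast
  show thesis
  proof (rule that)
    show "valid R p q c" by (rule valid_mono[OF c]) (auto simp: p'_def q'_def)
    have "card (same c (c s) R s) < cap p' q' (c s) s" using c s by (simp add: valid_def)
    then show "card (same c (c s) R s) + 1 < cap p q (c s) s"
      by (cases "c s") (auto simp: cap_def p'_def q'_def)
  qed
qed

text \<open>The two numbers below count the neighbours that speak against giving \<open>v\<close> the colour
  \<open>False\<close> and \<open>True\<close>, respectively.\<close>

lemma votes:
  assumes v: "v \<in> V" and Z: "Z = {z \<in> light. adj v z}" and R: "R = V - insert v Z"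
    and Z0: "Z0 \<subseteq> Z"
  shows "(card (same c False R v) + card {z \<in> Z - Z0. c (other v z) \<noteq> False})
    + (card (same c True R v) + card {z \<in> Z - Z0. c (other v z) \<noteq> True}) + card Z0 = dg v V"
proof -
  have finZ: "finite Z" "finite R" "finite Z0"
    using fin finite_subset[OF Z0] by (auto simp: Z R)
  have "nbs v R = same c False R v \<union> same c True R v"
    "same c False R v \<inter> same c True R v = {}"
    by (auto simp: nbs_def same_def)
  then have 1: "dg v R = card (same c False R v) + card (same c True R v)"
    using finZ by (simp add: dg_def card_Un_disjoint)
  have "Z = {z \<in> Z - Z0. c (other v z) \<noteq> False} \<union> {z \<in> Z - Z0. c (other v z) \<noteq> True} \<union> Z0"
    using Z0 by auto
  moreover have "card \<dots> = card {z \<in> Z - Z0. c (other v z) \<noteq> False}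
      + card {z \<in> Z - Z0. c (other v z) \<noteq> True} + card Z0"
    using finZ by (subst card_Un_disjoint; (subst card_Un_disjoint)?) auto
  ultimately have 2: "card Z = card {z \<in> Z - Z0. c (other v z) \<noteq> False}
      + card {z \<in> Z - Z0. c (other v z) \<noteq> True} + card Z0" by simp
  have "nbs v V = nbs v R \<union> Z" "nbs v R \<inter> Z = {}"
    using light_sub by (auto simp: nbs_def R Z)
  then have 3: "dg v V = dg v R + card Z"
    using finZ by (simp add: dg_def card_Un_disjoint)
  show ?thesis using 1 2 3 by simp
qed

text \<open>Reserve a \<open>False\<close> place at each neighbour of \<open>v\<close> in
  \<open>R\<close>. If fewer than \<open>q v\<close> votes speak against \<open>False\<close>, then
  \<open>False\<close> works for \<open>v\<close>. Otherwise all votes do, so \<open>v\<close> can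
  be \<open>True\<close> without any \<open>True\<close> neighbour in \<open>R\<close>; the stricter
  bound for \<open>p v = 0\<close> rules this case out there.\<close>

lemma degree_bound:
  assumes v: "v \<in> V" "q v \<ge> 2" "v \<notin> light"
    and d: "dg v V \<le> q v" "p v = 0 \<Longrightarrow> dg v V < q v"
  shows False
proof -
  define Z where "Z = {z \<in> light. adj v z}"
  define R where "R = V - insert v Z"
  define q' where "q' u = (if adj v u then q u - 1 else q u)" for u
  have finR: "finite R" using fin by (simp add: R_def)
  have RV: "R \<subset> V" using v by (auto simp: R_def)
  have wt': "wt p q' u \<ge> wt p q u - (if adj v u then 3 else 0)" for u
    using gq_dec[of "q u"] by (auto simp: wt_def q'_def)
  have wtv: "wt p q v \<le> 4 * int (p v) + 6"
    using gq_le q_le[OF v(1)] by (simp add: wt_def)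
  have big: "rho p q' U \<ge> - 5" if U: "U \<subseteq> R" "U \<noteq> {}" for U
  proof -
    have fU: "finite U" using U finR finite_subset by blast
    have vU: "v \<notin> U" "U \<subset> V" using U RV by (auto simp: R_def)
    have "rho p q' U \<ge> rho p q U - (\<Sum>u\<in>U. if adj v u then 3 else 0)"
      by (rule rho_change) (rule wt')
    then have rho': "rho p q' U \<ge> rho p q U - 3 * int (dg v U)" using fU by (simp add: sum_adj_int)
    have ge1: "rho p q U \<ge> - 1" using rho_ge_minus1 vU U by blast
    have ins: "rho p q (insert v U) = rho p q U + wt p q v - 9 * int (dg v U)"
      using rho_insert fU vU by blast
    \<comment> \<open>Adding \<open>v\<close> back bounds the new potential below by that of
      \<open>insert v U\<close> minus \<open>wt p q v\<close> plus 6 per edge. Two edges suffice if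
      the set is proper. For \<open>V\<close> itself, with only -5 available, three edges or
      \<open>p v \<le> 1\<close> are needed; this is ensured by \<open>v\<close> not being
      light.\<close>
    consider "dg v U \<le> 1" | "dg v U \<ge> 2" "insert v U \<noteq> V" | "dg v U \<ge> 2" "insert v U = V"
      by linarith
    then show ?thesis
    proof cases
      case 1
      then show ?thesis using rho' ge1 by linarith
    next
      case 2
      then have "insert v U \<subset> V" using vU v by blast
      then have "rho p q (insert v U) \<ge> - 1" using rho_ge_minus1 by blast
      moreover have "p v \<le> 2" using p_le v by blast
      ultimately show ?thesis using rho' ins wtv 2 by linarith
    next
      case 3
      then have "dg v U = dg v V" using dg_insert[OF fU vU(1), of v] by simp
      then have "p v \<le> 1" if "dg v U = 2"
        using that v p_le[OF v(1)] by (force simp: light_def)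
      then have "dg v U \<ge> 3 \<or> p v \<le> 1" using 3 by linarith
      moreover have "rho p q (insert v U) \<ge> - 5" using rho_ge_minus5 3 by simp
      moreover have "p v \<le> 2" using p_le v by blast
      ultimately show ?thesis using rho' ins wtv 3 by linarith
    qed
  qed
  have "admissible R p q'"
  proof (rule ccontr)
    assume na: "\<not> admissible R p q'"
    have bd: "p u \<le> 2 \<and> q' u \<le> 4" if "u \<in> R" for u
      using p_le[of u] q_le[of u] that by (auto simp: q'_def R_def)
    show False
    proof (rule not_admissible_cases[OF finR bd na])
      fix U assume "U \<subseteq> R" "U \<noteq> {}" "rho p q' U \<le> - 6"
      then show False using big[of U] by simp
    next
      fix U assume U: "U \<subseteq> R" "U \<noteq> {}" "rho p q' U \<le> - 3" "\<And>u. u \<in> U \<Longrightarrow> q' u = 0"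
      have "wt p q' u = wt p q u" if "u \<in> U" for u
        using U(4)[OF that] by (auto simp: wt_def gq_def q'_def split: if_splits)
      then have "rho p q' U = rho p q U" by (simp add: rho_def)
      moreover have "U \<subset> V" using U RV by blast
      ultimately show False using rho_ge_minus1[of U] U by simp
    qed
  qed
  then obtain c where c': "valid R p q' c" using IH RV by blast
  have c: "valid R p q c" by (rule valid_mono[OF c']) (auto simp: q'_def)
  have slF: "card (same c False R x) + 1 < cap p q False x" if "x \<in> R" "adj v x" "c x = False" for x
    using c' that by (force simp: valid_def cap_def q'_def)
  define i where "i \<longleftrightarrow> \<not> card (same c False R v) + card {z \<in> Z - {}. c (other v z) \<noteq> False} < q v"
  note vt = votes[OF v(1) Z_def R_def, of "{}" c]
  have finsame: "finite (same c True R v)" using finR by simp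
  have pv: "p v \<ge> 1" if i
  proof (rule ccontr)
    assume "\<not> 1 \<le> p v"
    then have "dg v V < q v" using d(2) by simp
    then show False using vt that by (simp add: i_def)
  qed
  show False
  proof (rule extend_light[OF v(1) _ R_def _ c])
    show "Z \<subseteq> {z \<in> light. adj v z}" by (simp add: Z_def)
    show "\<And>x. x \<in> Z \<Longrightarrow> other v x \<notin> Z" using other_not_light v(1) by (simp add: Z_def)
    show "card (same c i R v) + card {z \<in> Z - {}. c (other v z) \<noteq> i} < cap p q i v"
      using vt d(1) pv by (cases i) (auto simp: i_def cap_def)
    show "card (same c i R x) + 1 < cap p q i x" if "x \<in> R" "adj v x" "c x = i" for x
    proof (cases i)
      case True
      then have "card (same c True R v) = 0" using vt d(1) by (auto simp: i_def)
      then have "same c True R v = {}" using finsame by simp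
      then show ?thesis using that True by (auto simp: same_def)
    next
      case False
      then show ?thesis using slF[of x] that by simp
    qed
  qed simp_all
qed

text \<open>A vertex with at most one neighbour outside \<open>light\<close>: if one neighbour is neutralised by
  reserving room for it at its own end or at the far end of a light neighbour, only \<open>q v + 1\<close>
  votes remain, which is too few to exclude both colours.\<close>

lemma degree_bound_light:
  assumes v: "v \<in> V" "q v \<ge> 2" "v \<notin> light" "p v = 2"
  shows "dg v (V - light) = 0 \<Longrightarrow> dg v V \<ge> q v + 2"
    and "dg v (V - light) = 1 \<Longrightarrow> q v \<ge> 3 \<Longrightarrow> dg v V \<ge> q v + 2"
    and "dg v (V - light) = 0 \<Longrightarrow> q v \<ge> 3 \<Longrightarrow> dg v V \<ge> q v + 3"
proof -
  define Z where "Z = {z \<in> light. adj v z}"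
  define R where "R = V - insert v Z"
  have RV: "R \<subset> V" using v by (auto simp: R_def)
  have nbR: "nbs v R = nbs v (V - light)"
    using light_sub v by (auto simp: nbs_def R_def Z_def)
  have ZV: "Z \<subseteq> V" "v \<notin> Z" "finite Z" using light_sub by (auto simp: Z_def)
  have dZ: "dg v V = dg v (V - light) + card Z"
  proof -
    have "nbs v V = nbs v (V - light) \<union> Z" "nbs v (V - light) \<inter> Z = {}"
      using light_sub by (auto simp: nbs_def Z_def)
    then show ?thesis using fin ZV by (simp add: dg_def card_Un_disjoint)
  qed
  have lower: "dg v V \<ge> q v + 1" using degree_bound[of v] v by force
  have main: False
    if c: "valid R p q c" and Z0: "Z0 \<subseteq> Z" "\<And>z z'. z \<in> Z0 \<Longrightarrow> z' \<in> Z0 \<Longrightarrow> z = z'"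
      and d: "dg v V \<le> q v + 1 + card Z0"
      and slx: "\<And>x. x \<in> R \<Longrightarrow> adj v x \<Longrightarrow> card (same c (c x) R x) + 1 < cap p q (c x) x"
      and slz: "\<And>z. z \<in> Z0 \<Longrightarrow>
        card (same c (c (other v z)) R (other v z)) + 1 < cap p q (c (other v z)) (other v z)"
    for c Z0
  proof -
    define i where
      "i \<longleftrightarrow> \<not> card (same c False R v) + card {z \<in> Z - Z0. c (other v z) \<noteq> False} < q v"
    note vt = votes[OF v(1) Z_def R_def Z0(1), of c]
    show False
    proof (rule extend_light[OF v(1) _ R_def _ c Z0])
      show "Z \<subseteq> {z \<in> light. adj v z}" by (simp add: Z_def)
      show "\<And>x. x \<in> Z \<Longrightarrow> other v x \<notin> Z" using other_not_light v(1) by (simp add: Z_def)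
      show "card (same c i R v) + card {z \<in> Z - Z0. c (other v z) \<noteq> i} < cap p q i v"
        using vt d v(4) by (cases i) (auto simp: i_def cap_def)
      show "card (same c i R x) + 1 < cap p q i x" if "x \<in> R" "adj v x" "c x = i" for x
        using slx[OF that(1,2)] that(3) by simp
      show "card (same c (\<not> i) R (other v z)) + 1 < cap p q (\<not> i) (other v z)"
        if "z \<in> Z0" "c (other v z) \<noteq> i" for z
      proof -
        have "c (other v z) = (\<not> i)" using that(2) by auto
        then show ?thesis using slz[OF that(1)] by simp
      qed
    qed
  qed
  {
    assume D: "dg v (V - light) = 0"
    then have noR: "\<not> adj v x" if "x \<in> R" for x
      using that nbR fin by (auto simp: dg_def nbs_def R_def)
    show 1: "dg v V \<ge> q v + 2"
    proof (rule ccontr)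
      assume "\<not> ?thesis"
      then have d: "dg v V \<le> q v + 1 + card ({}::'a set)" by simp
      obtain c where c: "valid R p q c" using IH_valid RV by blast
      show False by (rule main[OF c _ _ d]) (use noR in auto)
    qed
    assume q: "q v \<ge> 3"
    show "dg v V \<ge> q v + 3"
    proof (rule ccontr)
      assume "\<not> ?thesis"
      then have deg: "dg v V = q v + 2" using 1 by simp
      then have "card Z \<ge> 5" using dZ D q by simp
      then obtain z1 where z1: "z1 \<in> Z" by fastforce
      have S: "insert v Z \<subseteq> V" "card (insert v Z) \<ge> 4"
        using v(1) ZV \<open>card Z \<ge> 5\<close> by auto
      have "other v z1 \<in> R"
        using other[of z1 v] other_not_light[of z1 v] z1 v(1) by (auto simp: R_def Z_def)
      then obtain c where c: "valid R p q c"
        "card (same c (c (other v z1)) R (other v z1)) + 1 < cap p q (c (other v z1)) (other v z1)"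
        using reserve_both[OF S R_def] by blast
      have d: "dg v V \<le> q v + 1 + card {z1}" using deg by simp
      show False by (rule main[OF c(1) _ _ d]) (use z1 noR c(2) in auto)
    qed
  next
    assume D: "dg v (V - light) = 1" and q: "q v \<ge> 3"
    show "dg v V \<ge> q v + 2"
    proof (rule ccontr)
      assume "\<not> ?thesis"
      then have deg: "dg v V = q v + 1" using lower by simp
      \<comment> \<open>With \<open>v\<close> these are the four vertices that
        \<open>reserve_both\<close> requires.\<close>
      then have "card Z \<ge> 3" using dZ D q by simp
      then have S: "insert v Z \<subseteq> V" "card (insert v Z) \<ge> 4"
        using v(1) ZV by auto
      obtain x where x: "nbs v R = {x}" using D nbR by (auto simp: dg_def card_1_singleton_iff)
      then have xR: "x \<in> R" by (auto simp: nbs_def)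
      obtain c where c: "valid R p q c" "card (same c (c x) R x) + 1 < cap p q (c x) x"
        using reserve_both[OF S R_def xR] by blast
      have xx: "u = x" if "u \<in> R" "adj v u" for u using that x by (auto simp: nbs_def)
      have d: "dg v V \<le> q v + 1 + card ({}::'a set)" using deg by simp
      show False by (rule main[OF c(1) _ _ d]) (use xx c(2) in auto)
    qed
  }
qed

section \<open>Heavy vertices and discharging\<close>

text \<open>The light vertices, the heavy ones and those with \<open>q \<le> 1\<close> partition
  \<open>V\<close>.\<close>

definition heavy :: "'a set" where
  "heavy = {v \<in> V. q v \<ge> 2 \<and> v \<notin> light}"

lemma heavy_sub: "heavy \<subseteq> V" and fin_heavy [simp]: "finite heavy"
  using fin by (auto simp: heavy_def)

lemma dg_split: "dg v V = dg v light + dg v (V - light)"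
proof -
  have "V = light \<union> (V - light)" using light_sub by blast
  then show ?thesis using dg_Un[of light "V - light" v] fin by simp
qed

text \<open>The first part says that the charge a heavy vertex receives covers its weight. The
  second concerns vertices that cannot be \<open>False\<close> together with all heavy neighbours:
  surplus plus heavy edges reach the 6 that contradicts admissibility, except in one borderline
  state, where they give 2 + 2.\<close>

lemma heavy_arith:
  assumes v: "v \<in> heavy"
  shows "wt p q v \<le> 2 * int (dg v light) + 4 * int (dg v (V - light))"
    and "dg v heavy \<ge> q v \<Longrightarrow>
      2 * int (dg v light) + 4 * int (dg v (V - light)) + int (dg v heavy) - wt p q v \<ge> 6 \<or>
      p v = 2 \<and> q v = 2 \<and> dg v light = 1 \<and> dg v (V - light) = 2 \<and> dg v heavy = 2"
proof -
  have v': "v \<in> V" "q v \<ge> 2" "v \<notin> light" using v by (auto simp: heavy_def)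
  have B: "dg v heavy \<le> dg v (V - light)"
    using fin by (intro dg_mono) (auto simp: heavy_def)
  have d: "dg v V = dg v light + dg v (V - light)" by (rule dg_split)
  have w: "wt p q v = 4 * int (p v) + 3 * int (q v) - 6" using v' by (simp add: wt_def gq_def)
  have q4: "q v \<le> 4" using q_le v' by blast
  have p: "p v = 0 \<or> p v = 1 \<or> p v = 2" using p_le[OF v'(1)] by linarith
  have b0: "dg v V \<ge> q v" using degree_bound[OF v'] by force
  have b1: "p v \<noteq> 0 \<Longrightarrow> dg v V \<ge> q v + 1" using degree_bound[OF v'] by force
  note b2 = degree_bound_light[OF v']
  show "wt p q v \<le> 2 * int (dg v light) + 4 * int (dg v (V - light))"
  proof (cases "p v = 2")
    case True
    consider "dg v (V - light) = 0" | "dg v (V - light) = 1" | "dg v (V - light) \<ge> 2" by linarith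
    then show ?thesis
    proof cases
      case 1
      then show ?thesis using b2(1,3)[OF True] w d v'(2) q4 True by (cases "q v \<ge> 3") auto
    next
      case 2
      then show ?thesis using b2(2)[OF True] b1 w d v'(2) q4 True by (cases "q v \<ge> 3") auto
    next
      case 3
      then show ?thesis using b1 w d q4 True by simp
    qed
  next
    case False
    then show ?thesis using p b0 b1 w d q4 v'(2) by auto
  qed
  assume bad: "dg v heavy \<ge> q v"
  show "2 * int (dg v light) + 4 * int (dg v (V - light)) + int (dg v heavy) - wt p q v \<ge> 6 \<or>
      p v = 2 \<and> q v = 2 \<and> dg v light = 1 \<and> dg v (V - light) = 2 \<and> dg v heavy = 2"
  proof (cases "p v = 2")
    case True
    then have "dg v light + dg v (V - light) \<ge> q v + 1" using b1 d by simp
    then show ?thesis using w bad B True v'(2) by linarith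
  next
    case False
    then show ?thesis using p b0 b1 w d v'(2) bad B by auto
  qed
qed

lemma sum_light_split:
  "(\<Sum>u\<in>V. if adj v u then if u \<in> light then a else b else 0)
    = a * int (dg v light) + b * int (dg v (V - light))"
proof -
  have "(\<Sum>u\<in>V. if adj v u then if u \<in> light then a else b else 0)
    = (\<Sum>u\<in>light. if adj v u then if u \<in> light then a else b else 0)
    + (\<Sum>u\<in>V - light. if adj v u then if u \<in> light then a else b else 0)"
    using sum.subset_diff[OF light_sub fin, of "\<lambda>u. if adj v u then if u \<in> light then a else b else 0"]
    by simp
  also have "(\<Sum>u\<in>light. if adj v u then if u \<in> light then a else b else 0)
    = (\<Sum>u\<in>light. if adj v u then a else 0)" by (intro sum.cong) auto
  also have "(\<Sum>u\<in>V - light. if adj v u then if u \<in> light then a else b else 0)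
    = (\<Sum>u\<in>V - light. if adj v u then b else 0)" by (intro sum.cong) auto
  finally show ?thesis using fin by (simp add: sum_adj_int)
qed

text \<open>Each edge distributes its cost \<open>9\<close> to its ends as \<open>7 + 2\<close> (light and other),
  \<open>4 + 5\<close> (heavy and low) or \<open>4 + 4\<close> (heavy and heavy, with one unit left over).\<close>

lemma discharge:
  "rho p q V \<le> (\<Sum>v\<in>heavy. wt p q v - 2 * int (dg v light) - 4 * int (dg v (V - light)))
    - int (ne heavy)"
proof -
  define pay :: "'a \<Rightarrow> 'a \<Rightarrow> int" where
    "pay v u = (if v \<in> light then 7 else if u \<in> light then 2 else if v \<in> heavy then 4 else 5)" for v u
  define bb :: "'a \<Rightarrow> 'a \<Rightarrow> int" where "bb v u = (if v \<in> heavy \<and> u \<in> heavy then 1 else 0)" for v u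
  define P where "P v = (\<Sum>u\<in>V. if adj v u then pay v u else 0)" for v
  \<comment> \<open>Only light-light pairs (14) and pairs with both \<open>q \<le> 1\<close> (10)
    would exceed 9, and these are not adjacent. The sums below run over ordered pairs, hence the
    factor 18.\<close>
  have edge: "pay v u + pay u v + bb v u \<le> 9" if "v \<in> V" "u \<in> V" "adj v u" for v u
    using that light_not_adjacent[of v u] low_q_not_adjacent[of v u]
    by (auto simp: pay_def bb_def heavy_def)
  have "(\<Sum>v\<in>V. \<Sum>u\<in>V. if adj v u then pay v u + pay u v + bb v u else 0)
    \<le> (\<Sum>v\<in>V. \<Sum>u\<in>V. if adj v u then 9 else 0)"
    using edge by (intro sum_mono) auto
  also have "\<dots> = 9 * int (\<Sum>v\<in>V. dg v V)"
    using fin by (simp add: sum_adj_int sum_distrib_left)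
  also have "\<dots> = 18 * int (ne V)" using sum_dg[OF fin] by simp
  finally have le: "(\<Sum>v\<in>V. \<Sum>u\<in>V. if adj v u then pay v u + pay u v + bb v u else 0)
    \<le> 18 * int (ne V)" .
  have "(\<Sum>v\<in>V. \<Sum>u\<in>V. if adj v u then pay v u + pay u v + bb v u else 0)
    = (\<Sum>v\<in>V. \<Sum>u\<in>V. (if adj v u then pay v u else 0) + (if adj v u then pay u v else 0)
        + (if adj v u then bb v u else 0))"
    by (intro sum.cong) auto
  also have "\<dots> = (\<Sum>v\<in>V. P v) + (\<Sum>v\<in>V. \<Sum>u\<in>V. if adj v u then pay u v else 0)
      + (\<Sum>v\<in>V. \<Sum>u\<in>V. if adj v u then bb v u else 0)"
    by (simp add: sum.distrib P_def)
  also have "(\<Sum>v\<in>V. \<Sum>u\<in>V. if adj v u then pay u v else 0) = (\<Sum>v\<in>V. P v)"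
    unfolding P_def by (subst sum.swap) (intro sum.cong refl, simp add: adj_sym)
  also have "(\<Sum>v\<in>V. \<Sum>u\<in>V. if adj v u then bb v u else 0) = 2 * int (ne heavy)"
  proof -
    have inner: "(\<Sum>u\<in>V. if adj v u then bb v u else 0) = (if v \<in> heavy then int (dg v heavy) else 0)"
      for v
    proof (cases "v \<in> heavy")
      case True
      have "(\<Sum>u\<in>V. if adj v u then bb v u else 0) = (\<Sum>u\<in>heavy. if adj v u then 1 else 0)"
        using True fin heavy_sub
        by (intro sum.mono_neutral_cong_right) (auto simp: bb_def)
      then show ?thesis using True by (simp add: sum_adj_int)
    next
      case False
      have "(\<Sum>u\<in>V. if adj v u then bb v u else 0) = (\<Sum>u\<in>V. 0)"
        using False by (intro sum.cong) (auto simp: bb_def)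
      then show ?thesis using False by simp
    qed
    have "(\<Sum>v\<in>V. if v \<in> heavy then int (dg v heavy) else 0) = (\<Sum>v\<in>heavy. int (dg v heavy))"
      using fin heavy_sub by (intro sum.mono_neutral_cong_right) auto
    also have "\<dots> = 2 * int (ne heavy)" using sum_dg[OF fin_heavy] by (simp flip: of_nat_sum)
    finally show ?thesis by (simp add: inner)
  qed
  finally have two: "2 * (\<Sum>v\<in>V. P v) + 2 * int (ne heavy) \<le> 18 * int (ne V)"
    using le by linarith
  have Pheavy: "P v = 2 * int (dg v light) + 4 * int (dg v (V - light))" if "v \<in> heavy" for v
  proof -
    have "P v = (\<Sum>u\<in>V. if adj v u then if u \<in> light then 2 else 4 else 0)"
      unfolding P_def using that by (intro sum.cong) (auto simp: pay_def heavy_def)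
    then show ?thesis by (simp add: sum_light_split)
  qed
  \<comment> \<open>A light vertex receives 7 from each of its two edges, the maximal weight 14. A
    vertex with \<open>q \<le> 1\<close> weighs 5 and receives 5 from a neighbour that is not
    light.\<close>
  have rest: "wt p q v - P v \<le> 0" if v: "v \<in> V - heavy" for v
  proof (cases "v \<in> light")
    case True
    have "P v = (\<Sum>u\<in>V. if adj v u then 7 else 0)"
      unfolding P_def using True by (intro sum.cong) (auto simp: pay_def)
    then have "P v = 14" using fin True by (simp add: sum_adj_int light_def)
    moreover have "wt p q v \<le> 14" using True gq_le q_le[of v] by (auto simp: wt_def light_def)
    ultimately show ?thesis by simp
  next
    case False
    then have low: "q v \<le> 1" "v \<in> V" using v by (auto simp: heavy_def)
    have "P v = (\<Sum>u\<in>V. if adj v u then if u \<in> light then 2 else 5 else 0)"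
      unfolding P_def using False v by (intro sum.cong) (auto simp: pay_def)
    then have "P v = 2 * int (dg v light) + 5 * int (dg v (V - light))"
      by (simp add: sum_light_split)
    moreover have "wt p q v = 5" using low low_q_p_eq_2 by (simp add: wt_def gq_def)
    ultimately show ?thesis using low_q_heavy_neighbour[of v] low by simp
  qed
  have "(\<Sum>v\<in>V. wt p q v - P v) = (\<Sum>v\<in>V - heavy. wt p q v - P v) + (\<Sum>v\<in>heavy. wt p q v - P v)"
    using fin heavy_sub by (rule sum.subset_diff[rotated])
  also have "\<dots> \<le> (\<Sum>v\<in>heavy. wt p q v - P v)"
    using sum_nonpos[of "V - heavy", OF rest] by simp
  also have "\<dots> = (\<Sum>v\<in>heavy. wt p q v - 2 * int (dg v light) - 4 * int (dg v (V - light)))"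
    using Pheavy by (intro sum.cong) auto
  finally show ?thesis using two by (simp add: rho_def sum_subtractf)
qed

lemma ne_ge_dg: "v \<in> heavy \<Longrightarrow> dg v heavy \<le> ne heavy"
proof -
  assume v: "v \<in> heavy"
  have "ne (insert v (heavy - {v})) = ne (heavy - {v}) + dg v (heavy - {v})"
    by (rule ne_insert) auto
  moreover have "nbs v heavy = nbs v (heavy - {v})" by (auto simp: nbs_def)
  ultimately show ?thesis using v by (simp add: insert_absorb dg_def)
qed

section \<open>The exceptional vertex and the final colouring\<close>

definition exceptional :: "'a set" where
  "exceptional = {v \<in> heavy. dg v heavy \<ge> q v}"

text \<open>In any other state the surplus of \<open>v\<close> and its heavy edges already force
  \<open>rho p q V \<le> -6\<close> by \<open>discharge\<close>.\<close>

lemma exceptional_state: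
  assumes v: "v \<in> exceptional"
  shows "p v = 2 \<and> q v = 2 \<and> dg v light = 1 \<and> dg v (V - light) = 2 \<and> dg v heavy = 2"
proof (rule ccontr)
  assume "\<not> ?thesis"
  then have f: "2 * int (dg v light) + 4 * int (dg v (V - light)) + int (dg v heavy) - wt p q v \<ge> 6"
    using heavy_arith(2)[of v] v by (auto simp: exceptional_def)
  have vh: "v \<in> heavy" using v by (simp add: exceptional_def)
  have "(\<Sum>v\<in>heavy. wt p q v - 2 * int (dg v light) - 4 * int (dg v (V - light)))
    = (wt p q v - 2 * int (dg v light) - 4 * int (dg v (V - light)))
    + (\<Sum>v\<in>heavy - {v}. wt p q v - 2 * int (dg v light) - 4 * int (dg v (V - light)))"
    using vh by (simp add: sum.remove)
  moreover have "(\<Sum>v\<in>heavy - {v}. wt p q v - 2 * int (dg v light) - 4 * int (dg v (V - light))) \<le> 0"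
    using heavy_arith(1) by (intro sum_nonpos) (auto simp: algebra_simps)
  ultimately have "rho p q V \<le> - 6"
    using discharge f ne_ge_dg[OF vh] by linarith
  then show False using rho_ge_minus5[of V] by simp
qed

text \<open>Two such vertices contribute a surplus of 2 each, and there are at least two heavy
  edges: again -6 in total.\<close>

lemma exceptional_unique:
  assumes v: "v \<in> exceptional" "w \<in> exceptional"
  shows "v = w"
proof (rule ccontr)
  assume neq: "v \<noteq> w"
  have vh: "v \<in> heavy" "w \<in> heavy" using v by (auto simp: exceptional_def)
  let ?f = "\<lambda>v. wt p q v - 2 * int (dg v light) - 4 * int (dg v (V - light))"
  have "(\<Sum>v\<in>heavy. ?f v) = ?f v + ?f w + (\<Sum>v\<in>heavy - {v} - {w}. ?f v)"
    using vh neq by (simp add: sum.remove[of heavy v] sum.remove[of "heavy - {v}" w])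
  moreover have "(\<Sum>v\<in>heavy - {v} - {w}. ?f v) \<le> 0"
    using heavy_arith(1) by (intro sum_nonpos) (auto simp: algebra_simps)
  moreover have "?f v = - 2" "?f w = - 2"
    using exceptional_state[OF v(1)] exceptional_state[OF v(2)] by (simp_all add: wt_def gq_def)
  moreover have "ne heavy \<ge> 2" using ne_ge_dg[OF vh(1)] exceptional_state[OF v(1)] by simp
  ultimately have "rho p q V \<le> - 6" using discharge by linarith
  then show False using rho_ge_minus5[of V] by simp
qed

text \<open>In the borderline state both neighbours outside \<open>light\<close> are heavy.\<close>

lemma exceptional_not_low:
  assumes v: "v \<in> exceptional" and u: "u \<in> V" "q u \<le> 1"
  shows "\<not> adj v u"
proof
  assume "adj v u"
  then have "u \<in> nbs v (V - light)" "u \<notin> nbs v heavy"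
    using u by (auto simp: nbs_def light_def heavy_def)
  moreover have "nbs v heavy \<subseteq> nbs v (V - light)" by (auto simp: nbs_def heavy_def)
  ultimately have "nbs v heavy \<subset> nbs v (V - light)" by blast
  then have "dg v heavy < dg v (V - light)"
    unfolding dg_def using fin by (intro psubset_card_mono) auto
  then show False using exceptional_state[OF v] by simp
qed

lemma contradiction: False
proof -
  \<comment> \<open>Heavy vertices are \<open>False\<close> unless exceptional. A light vertex next
    to a \<open>False\<close> heavy one is \<open>True\<close>, so it agrees with at most one
    neighbour; any other light vertex with \<open>q \<ge> 2\<close> sees only \<open>True\<close>
    neighbours and is \<open>False\<close>.\<close>
  define c where "c u \<longleftrightarrow> q u \<le> 1 \<or> u \<in> exceptional \<or>
    u \<in> light \<and> (\<exists>w\<in>heavy - exceptional. adj u w)" for u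
  have cheavy: "\<not> c u" if "u \<in> heavy - exceptional" for u
    using that by (auto simp: c_def heavy_def)
  have "card (same c (c u) V u) < cap p q (c u) u" if u: "u \<in> V" for u
  proof -
    consider "q u \<le> 1" | "u \<in> exceptional" | "u \<in> heavy - exceptional" | "u \<in> light" "c u"
      | "u \<in> light" "\<not> c u" "q u \<ge> 2"
    proof -
      have "q u \<le> 1 \<or> q u \<ge> 2" by linarith
      then show thesis using that u by (auto simp: heavy_def)
    qed
    then show ?thesis
    proof cases
      case 1
      \<comment> \<open>A \<open>True\<close> neighbour of \<open>u\<close> can be neither
        exceptional nor have \<open>q \<le> 1\<close>, so it is light, and there is at most one such
        neighbour.\<close>
      have "w = w'" if "w \<in> same c True V u" "w' \<in> same c True V u" for w w'
      proof -
        have "w \<in> light" if "w \<in> same c True V u" for w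
          using that low_q_not_adjacent[OF u 1, of w] exceptional_not_low[of w u] u 1
          by (auto simp: same_def c_def adj_sym)
        then show ?thesis using that low_q_light_neighbour[OF u 1, of w w'] by (auto simp: same_def)
      qed
      then have "same c True V u = {} \<or> (\<exists>w. same c True V u = {w})" by blast
      then have "card (same c True V u) \<le> 1" by auto
      then show ?thesis using 1 low_q_p_eq_2[OF u 1] by (simp add: c_def cap_def)
    next
      case 2
      have "same c True V u \<subseteq> nbs u light"
        using exceptional_not_low[OF 2] exceptional_unique[OF 2]
        by (auto simp: same_def nbs_def c_def)
      then have "card (same c True V u) \<le> dg u light"
        unfolding dg_def by (intro card_mono) auto
      then show ?thesis using 2 exceptional_state[OF 2] by (simp add: c_def cap_def)
    next
      case 3
      have "same c False V u \<subseteq> nbs u heavy"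
        using 3 by (auto simp: same_def nbs_def c_def heavy_def adj_sym)
      then have "card (same c False V u) \<le> dg u heavy"
        unfolding dg_def by (intro card_mono) auto
      also have "\<dots> < q u" using 3 by (auto simp: exceptional_def)
      finally show ?thesis using cheavy[OF 3] by (simp add: cap_def)
    next
      case 4
      then have "u \<notin> exceptional" "q u > 1" by (auto simp: exceptional_def heavy_def light_def)
      then obtain w where w: "w \<in> heavy - exceptional" "adj u w" using 4 by (auto simp: c_def)
      have "same c True V u \<subseteq> nbs u V - {w}"
        using cheavy[OF w(1)] by (auto simp: same_def nbs_def)
      then have "card (same c True V u) \<le> card (nbs u V - {w})"
        using fin by (intro card_mono) auto
      also have "\<dots> = 1" using 4(1) w heavy_sub fin
        by (subst card_Diff_singleton) (auto simp: nbs_def light_def dg_def)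
      finally show ?thesis using 4 by (simp add: cap_def light_def)
    next
      case 5
      have "c w" if "w \<in> V" "adj u w" for w
      proof -
        have "w \<notin> heavy - exceptional" using 5 that by (auto simp: c_def)
        moreover have "w \<notin> light" using 5 that light_not_adjacent by blast
        ultimately show ?thesis using that by (auto simp: c_def heavy_def)
      qed
      then have "same c False V u = {}" by (auto simp: same_def)
      then show ?thesis using 5 by (simp add: cap_def)
    qed
  qed
  then have "valid V p q c" by (simp add: valid_def)
  then show False using nocol by blast
qed

end

section \<open>From admissible capacities to (1,3)-colourings\<close>

context simple_edges
begin

text \<open>The capacities vary in the induction, since proper subsets are coloured under lowered
  ones.\<close>

lemma admissible_colourable:
  assumes "finite V" "admissible V p q"
  shows "\<exists>c. valid V p q c"
  using assms
proof (induction "card V" arbitrary: V p q rule: less_induct)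
  case less
  show ?case
  proof (rule ccontr)
    assume no: "\<nexists>c. valid V p q c"
    interpret min_counterexample E V p q
    proof
      fix R p' q' assume R: "R \<subset> V" "admissible R p' q'"
      then have "card R < card V" "finite R"
        using less.prems(1) finite_subset by (auto intro: psubset_card_mono)
      then show "\<exists>c. valid R p' q' c" using less.hyps R by blast
    qed (use less.prems no in auto)
    show False by (rule contradiction)
  qed
qed

lemma degree_induced:
  assumes "v \<in> W"
  shows "degree (induced_edges E W) v = dg v W"
proof -
  have "{e \<in> induced_edges E W. v \<in> e} = (\<lambda>u. {v, u}) ` nbs v W" (is "?l = ?r")
  proof
    show "?l \<subseteq> ?r"
    proof
      fix e assume e: "e \<in> ?l"
      then have "e \<in> E" "e \<subseteq> W" "v \<in> e" by (auto simp: induced_edges_def)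
      then obtain u where "e = {v, u}"
        using card_edge[of e] by (auto simp: card_2_iff)
      then show "e \<in> ?r" using \<open>e \<in> E\<close> \<open>e \<subseteq> W\<close> by (auto simp: nbs_def adj_def)
    qed
    show "?r \<subseteq> ?l" using assms by (auto simp: induced_edges_def nbs_def adj_def)
  qed
  moreover have "inj_on (\<lambda>u. {v, u}) (nbs v W)"
    by (auto simp: inj_on_def doubleton_eq_iff)
  ultimately show ?thesis by (simp add: degree_def dg_def card_image)
qed

end

theorem theorem1:
  fixes V :: "'a set" and E :: "'a set set"
  assumes "finite_simple_graph V E"
    and "\<And>W F. subgraph W F V E \<Longrightarrow> real (card F) \<le> (14 * real (card W) + 5) / 9"
  shows "colorable 1 3 V E"
proof -
  interpret simple_edges E
    using assms(1) by unfold_locales (auto simp: finite_simple_graph_def)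
  have fin: "finite V" using assms(1) by (simp add: finite_simple_graph_def)
  \<comment> \<open>Nine times the edge bound for the subgraph induced on \<open>U\<close>.
    Capacities 2 and 4 are strict bounds, hence degrees at most 1 and 3.\<close>
  have "rho (\<lambda>_. 2) (\<lambda>_. 4) U \<ge> - 5" if U: "U \<subseteq> V" for U
  proof -
    have "finite U" using U fin finite_subset by blast
    then have "subgraph U (induced_edges E U) V E"
      using assms(1) U by (auto simp: subgraph_def finite_simple_graph_def induced_edges_def)
    then have "real (ne U) \<le> (14 * real (card U) + 5) / 9"
      unfolding ne_def by (rule assms(2))
    then have "real (9 * ne U) \<le> real (14 * card U + 5)" by simp
    then have "9 * ne U \<le> 14 * card U + 5" by (simp only: of_nat_le_iff)
    then show ?thesis by (simp add: rho_def wt_def gq_def)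
  qed
  then have "admissible V (\<lambda>_. 2) (\<lambda>_. 4)" by (simp add: admissible_def)
  then obtain c where c: "valid V (\<lambda>_. 2) (\<lambda>_. 4) c"
    using admissible_colourable[OF fin] by blast
  have same: "same c b V v = nbs v {u \<in> V. c u = b}" for b v
    by (auto simp: same_def nbs_def)
  have "dg v {u \<in> V. c u = c v} < (if c v then 2 else 4)" if "v \<in> V" for v
    using c that by (simp add: valid_def cap_def same dg_def)
  then have less: "degree (induced_edges E {u \<in> V. c u = c v}) v < (if c v then 2 else 4)"
    if "v \<in> V" for v
    using that by (simp add: degree_induced)
  show ?thesis
    unfolding colorable_def
  proof (intro exI conjI ballI)
    show "degree (induced_edges E {u \<in> V. c u = True}) v \<le> 1" if "v \<in> {u \<in> V. c u = True}" for v
      using less[of v] that by simp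
    show "degree (induced_edges E {u \<in> V. c u = False}) v \<le> 3" if "v \<in> {u \<in> V. c u = False}" for v
      using less[of v] that by simp
  qed auto
qed

end
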